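(* The category of exact $\mathfrak{K}$-modules $M$ with $\alpha_{21}=0$ is equivalent to the category of triples $(M_0,\dot M_2,\dot\alpha)$ where (i) $M_0$ is a $\mathbb{Z}/2$-graded $\mathfrak{S}$-module with $\ker(1-t)=\operatorname{im}N(t)$; (ii) $\dot M_2\subseteq H_0(M_0):=\ker N(t)/\operatorname{im}(1-t)$ is a $\mathbb{Z}/2$-graded $\mathbb{Z}/p$-vector subspace; (iii) $\dot\alpha\colon\dot M_2\to H_0(M_0)/\dot M_2$ is a grading-reversing isomorphism. Morphisms of triples $(M_0,\dot M_2,\dot\alpha)\to(L_0,\dot L_2,\dot\beta)$ are grading-preserving $\mathfrak{S}$-module homomorphisms $f_0\colon M_0\to L_0$ such that $H_0(f_0)$ maps $\dot M_2$ to $\dot L_2$ and intertwines $\dot\alpha$ and $\dot\beta$. The homomorphism of exact $\mathfrak{K}$-modules induced by a morphism of triples $f_0$ is injective if and only if $f_0$ is injective and $f_0^{-1}(\tilde L_2)=\tilde M_2$; it is surjective if and only if $f_0$ is surjective and $f_0(\tilde M_2)=\tilde L_2$, where $\tilde M_2\subseteq\ker N(t)\subseteq M_0$ and $\tilde L_2\subseteq L_0$ denote the preimages of $\dot M_2$ and $\dot L_2$.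
   Context: Fix a prime $p$, $N(x)=1+x+\dots+x^{p-1}$, $\mathfrak{S}=\mathbb{Z}[t]/(t^p-1)$. A $\mathfrak{K}$-module $M$ amounts to $\mathbb{Z}/2$-graded abelian groups $M_0,M_1,M_2$ with homomorphisms $\alpha_{jk}\colon M_k\to M_j$ ($j\neq k$; $\alpha_{12},\alpha_{21}$ grading-reversing, others grading-preserving) with $\alpha_{jk}\alpha_{km}=0$ for $\{j,k,m\}=\{0,1,2\}$ and, for $t_0:=1-\alpha_{02}\alpha_{20}$ on $M_0$, $s_1:=1-\alpha_{12}\alpha_{21}$ on $M_1$, $t_2:=1-\alpha_{20}\alpha_{02}$, $s_2:=1-\alpha_{21}\alpha_{12}$ on $M_2$: $\alpha_{01}\alpha_{10}=N(t_0)$, $\alpha_{10}\alpha_{01}=N(s_1)$, $N(t_2)+N(s_2)=p$; morphisms are triples of grading-preserving maps commuting with all $\alpha_{jk}$. $M$ is exact if the cyclic sequences $M_0\xrightarrow{\alpha_{10}}M_1\xrightarrow{\alpha_{21}}M_2\xrightarrow{\alpha_{02}}M_0$ and $M_0\xrightarrow{\alpha_{20}}M_2\xrightarrow{\alpha_{12}}M_1\xrightarrow{\alpha_{01}}M_0$ are exact. The equivalence sends $M$ (with $\alpha_{21}=0$, so $\alpha_{02}$ is injective and $\alpha_{10}$ surjective with kernel $\alpha_{02}(M_2)$) to the triple with $M_0$ carrying $t=t_0$, $\dot M_2:=\alpha_{02}(M_2)/\operatorname{im}(1-t)$, and $\dot\alpha([\alpha_{02}(x)]):=[y]$ for $y\in\ker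 N(t)$ with $\alpha_{10}(y)=\alpha_{12}(x)$; it sends a $\mathfrak{K}$-module homomorphism to its component on $M_0$. *)

theory Defs
  imports "HOL-Algebra.Algebra"
begin

(* Abelian groups are HOL-Algebra (comm_)groups, written multiplicatively:
   the group law "+" of the paper is \<otimes>, 0 is \<one>, -x is inv x, n*x is x [^] n.
   A Z/2-grading of G is a pair (A0, A1) of subgroups with G = A0 (+) A1 (internal direct sum). *)

definition graded :: "'a monoid \<Rightarrow> 'a set \<times> 'a set \<Rightarrow> bool" where
  "graded G gr \<longleftrightarrow> comm_group G \<and> subgroup (fst gr) G \<and> subgroup (snd gr) G \<and>
     (\<forall>x\<in>carrier G. \<exists>!ab. fst ab \<in> fst gr \<and> snd ab \<in> snd gr \<and> x = fst ab \<otimes>\<^bsub>G\<^esub> snd ab)"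

definition gpres :: "('a \<Rightarrow> 'b) \<Rightarrow> 'a monoid \<Rightarrow> 'a set \<times> 'a set \<Rightarrow> 'b monoid \<Rightarrow> 'b set \<times> 'b set \<Rightarrow> bool" where
  "gpres f G g H h \<longleftrightarrow> f \<in> hom G H \<and> f ` fst g \<subseteq> fst h \<and> f ` snd g \<subseteq> snd h"

definition grev :: "('a \<Rightarrow> 'b) \<Rightarrow> 'a monoid \<Rightarrow> 'a set \<times> 'a set \<Rightarrow> 'b monoid \<Rightarrow> 'b set \<times> 'b set \<Rightarrow> bool" where
  "grev f G g H h \<longleftrightarrow> f \<in> hom G H \<and> f ` fst g \<subseteq> snd h \<and> f ` snd g \<subseteq> fst h"

definition Nop :: "nat \<Rightarrow> 'a monoid \<Rightarrow> ('a \<Rightarrow> 'a) \<Rightarrow> 'a \<Rightarrow> 'a" where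
  "Nop p G t x = (\<Otimes>\<^bsub>G\<^esub> i\<in>{..<p}. (t ^^ i) x)"

definition om :: "'a monoid \<Rightarrow> ('a \<Rightarrow> 'a) \<Rightarrow> 'a \<Rightarrow> 'a" where
  "om G t x = x \<otimes>\<^bsub>G\<^esub> inv\<^bsub>G\<^esub> (t x)"

record ('a, 'b, 'c) kmod =
  KG0 :: "'a monoid"  Kgr0 :: "'a set \<times> 'a set"
  KG1 :: "'b monoid"  Kgr1 :: "'b set \<times> 'b set"
  KG2 :: "'c monoid"  Kgr2 :: "'c set \<times> 'c set"
  a01 :: "'b \<Rightarrow> 'a"  a02 :: "'c \<Rightarrow> 'a"
  a10 :: "'a \<Rightarrow> 'b"  a12 :: "'c \<Rightarrow> 'b"
  a20 :: "'a \<Rightarrow> 'c"  a21 :: "'b \<Rightarrow> 'c"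

definition kmodule :: "nat \<Rightarrow> ('a, 'b, 'c) kmod \<Rightarrow> bool" where
  "kmodule p M \<longleftrightarrow>
     graded (KG0 M) (Kgr0 M) \<and> graded (KG1 M) (Kgr1 M) \<and> graded (KG2 M) (Kgr2 M) \<and>
     gpres (a10 M) (KG0 M) (Kgr0 M) (KG1 M) (Kgr1 M) \<and>
     gpres (a01 M) (KG1 M) (Kgr1 M) (KG0 M) (Kgr0 M) \<and>
     gpres (a02 M) (KG2 M) (Kgr2 M) (KG0 M) (Kgr0 M) \<and>
     gpres (a20 M) (KG0 M) (Kgr0 M) (KG2 M) (Kgr2 M) \<and>
     grev (a12 M) (KG2 M) (Kgr2 M) (KG1 M) (Kgr1 M) \<and>
     grev (a21 M) (KG1 M) (Kgr1 M) (KG2 M) (Kgr2 M) \<and>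
     (\<forall>x\<in>carrier (KG2 M). a01 M (a12 M x) = \<one>\<^bsub>KG0 M\<^esub>) \<and>
     (\<forall>x\<in>carrier (KG1 M). a02 M (a21 M x) = \<one>\<^bsub>KG0 M\<^esub>) \<and>
     (\<forall>x\<in>carrier (KG2 M). a10 M (a02 M x) = \<one>\<^bsub>KG1 M\<^esub>) \<and>
     (\<forall>x\<in>carrier (KG0 M). a12 M (a20 M x) = \<one>\<^bsub>KG1 M\<^esub>) \<and>
     (\<forall>x\<in>carrier (KG1 M). a20 M (a01 M x) = \<one>\<^bsub>KG2 M\<^esub>) \<and>
     (\<forall>x\<in>carrier (KG0 M). a21 M (a10 M x) = \<one>\<^bsub>KG2 M\<^esub>) \<and>
     (\<forall>x\<in>carrier (KG0 M). a01 M (a10 M x) = Nop p (KG0 M) (om (KG0 M) (a02 M \<circ> a20 M)) x) \<and>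
     (\<forall>x\<in>carrier (KG1 M). a10 M (a01 M x) = Nop p (KG1 M) (om (KG1 M) (a12 M \<circ> a21 M)) x) \<and>
     (\<forall>x\<in>carrier (KG2 M).
        Nop p (KG2 M) (om (KG2 M) (a20 M \<circ> a02 M)) x \<otimes>\<^bsub>KG2 M\<^esub> Nop p (KG2 M) (om (KG2 M) (a21 M \<circ> a12 M)) x
        = x [^]\<^bsub>KG2 M\<^esub> p)"

definition kexact :: "('a, 'b, 'c) kmod \<Rightarrow> bool" where
  "kexact M \<longleftrightarrow>
     a10 M ` carrier (KG0 M) = {y\<in>carrier (KG1 M). a21 M y = \<one>\<^bsub>KG2 M\<^esub>} \<and>
     a21 M ` carrier (KG1 M) = {z\<in>carrier (KG2 M). a02 M z = \<one>\<^bsub>KG0 M\<^esub>} \<and>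
     a02 M ` carrier (KG2 M) = {x\<in>carrier (KG0 M). a10 M x = \<one>\<^bsub>KG1 M\<^esub>} \<and>
     a20 M ` carrier (KG0 M) = {z\<in>carrier (KG2 M). a12 M z = \<one>\<^bsub>KG1 M\<^esub>} \<and>
     a12 M ` carrier (KG2 M) = {y\<in>carrier (KG1 M). a01 M y = \<one>\<^bsub>KG0 M\<^esub>} \<and>
     a01 M ` carrier (KG1 M) = {x\<in>carrier (KG0 M). a20 M x = \<one>\<^bsub>KG2 M\<^esub>}"

definition kexact0 :: "nat \<Rightarrow> ('a, 'b, 'c) kmod \<Rightarrow> bool" where
  "kexact0 p M \<longleftrightarrow> kmodule p M \<and> kexact M \<and> (\<forall>y\<in>carrier (KG1 M). a21 M y = \<one>\<^bsub>KG2 M\<^esub>)"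

definition khoms :: "('a, 'b, 'c) kmod \<Rightarrow> ('d, 'e, 'f) kmod \<Rightarrow>
    (('a \<Rightarrow> 'd) \<times> ('b \<Rightarrow> 'e) \<times> ('c \<Rightarrow> 'f)) set" where
  "khoms M L = {(f0, f1, f2).
     gpres f0 (KG0 M) (Kgr0 M) (KG0 L) (Kgr0 L) \<and>
     gpres f1 (KG1 M) (Kgr1 M) (KG1 L) (Kgr1 L) \<and>
     gpres f2 (KG2 M) (Kgr2 M) (KG2 L) (Kgr2 L) \<and>
     f0 \<in> extensional (carrier (KG0 M)) \<and> f1 \<in> extensional (carrier (KG1 M)) \<and>
     f2 \<in> extensional (carrier (KG2 M)) \<and>
     (\<forall>x\<in>carrier (KG1 M). f0 (a01 M x) = a01 L (f1 x)) \<and>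
     (\<forall>x\<in>carrier (KG2 M). f0 (a02 M x) = a02 L (f2 x)) \<and>
     (\<forall>x\<in>carrier (KG0 M). f1 (a10 M x) = a10 L (f0 x)) \<and>
     (\<forall>x\<in>carrier (KG2 M). f1 (a12 M x) = a12 L (f2 x)) \<and>
     (\<forall>x\<in>carrier (KG0 M). f2 (a20 M x) = a20 L (f0 x)) \<and>
     (\<forall>x\<in>carrier (KG1 M). f2 (a21 M x) = a21 L (f1 x))}"

definition kerN :: "nat \<Rightarrow> 'a monoid \<Rightarrow> ('a \<Rightarrow> 'a) \<Rightarrow> 'a set" where
  "kerN p G t = {x\<in>carrier G. Nop p G t x = \<one>\<^bsub>G\<^esub>}"

definition imom :: "'a monoid \<Rightarrow> ('a \<Rightarrow> 'a) \<Rightarrow> 'a set" where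
  "imom G t = om G t ` carrier G"

definition H0 :: "nat \<Rightarrow> 'a monoid \<Rightarrow> ('a \<Rightarrow> 'a) \<Rightarrow> 'a set monoid" where
  "H0 p G t = (G\<lparr>carrier := kerN p G t\<rparr>) Mod (imom G t)"

definition qgr :: "'a monoid \<Rightarrow> 'a set \<Rightarrow> 'a set \<times> 'a set \<Rightarrow> 'a set set \<times> 'a set set" where
  "qgr G N gr = ((\<lambda>a. N #>\<^bsub>G\<^esub> a) ` fst gr, (\<lambda>a. N #>\<^bsub>G\<^esub> a) ` snd gr)"

definition H0gr :: "nat \<Rightarrow> 'a monoid \<Rightarrow> 'a set \<times> 'a set \<Rightarrow> ('a \<Rightarrow> 'a) \<Rightarrow> 'a set set \<times> 'a set set" where
  "H0gr p G gr t = qgr G (imom G t) (fst gr \<inter> kerN p G t, snd gr \<inter> kerN p G t)"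

record 'a ktriple =
  TG :: "'a monoid"
  Tgr :: "'a set \<times> 'a set"
  Tt :: "'a \<Rightarrow> 'a"
  TD :: "'a set set"
  Tal :: "'a set \<Rightarrow> 'a set set"

abbreviation TH0 :: "nat \<Rightarrow> 'a ktriple \<Rightarrow> 'a set monoid" where
  "TH0 p T \<equiv> H0 p (TG T) (Tt T)"

abbreviation TH0gr :: "nat \<Rightarrow> 'a ktriple \<Rightarrow> 'a set set \<times> 'a set set" where
  "TH0gr p T \<equiv> H0gr p (TG T) (Tgr T) (Tt T)"

definition valid_triple :: "nat \<Rightarrow> 'a ktriple \<Rightarrow> bool" where
  "valid_triple p T \<longleftrightarrow>
     graded (TG T) (Tgr T) \<and> gpres (Tt T) (TG T) (Tgr T) (TG T) (Tgr T) \<and>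
     (\<forall>x\<in>carrier (TG T). (Tt T ^^ p) x = x) \<and>
     {x\<in>carrier (TG T). om (TG T) (Tt T) x = \<one>\<^bsub>TG T\<^esub>} = Nop p (TG T) (Tt T) ` carrier (TG T) \<and>
     subgroup (TD T) (TH0 p T) \<and>
     (\<forall>C\<in>TD T. \<exists>a\<in>TD T \<inter> fst (TH0gr p T). \<exists>b\<in>TD T \<inter> snd (TH0gr p T). C = a \<otimes>\<^bsub>TH0 p T\<^esub> b) \<and>
     Tal T \<in> iso ((TH0 p T)\<lparr>carrier := TD T\<rparr>) (TH0 p T Mod TD T) \<and>
     Tal T ` (TD T \<inter> fst (TH0gr p T)) \<subseteq> snd (qgr (TH0 p T) (TD T) (TH0gr p T)) \<and>
     Tal T ` (TD T \<inter> snd (TH0gr p T)) \<subseteq> fst (qgr (TH0 p T) (TD T) (TH0gr p T))"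

definition H0map :: "'b monoid \<Rightarrow> ('b \<Rightarrow> 'b) \<Rightarrow> ('a \<Rightarrow> 'b) \<Rightarrow> 'a set \<Rightarrow> 'b set" where
  "H0map L tU f C = (\<Union>x\<in>C. imom L tU #>\<^bsub>L\<^esub> f x)"

definition Dmap :: "nat \<Rightarrow> 'b ktriple \<Rightarrow> ('a \<Rightarrow> 'b) \<Rightarrow> 'a set set \<Rightarrow> 'b set set" where
  "Dmap p U f Y = \<Union> ((\<lambda>C. r_coset (TH0 p U) (TD U) (H0map (TG U) (Tt U) f C)) ` Y)"

definition thoms :: "nat \<Rightarrow> 'a ktriple \<Rightarrow> 'b ktriple \<Rightarrow> ('a \<Rightarrow> 'b) set" where
  "thoms p T U = {f.
     gpres f (TG T) (Tgr T) (TG U) (Tgr U) \<and> f \<in> extensional (carrier (TG T)) \<and>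
     (\<forall>x\<in>carrier (TG T). f (Tt T x) = Tt U (f x)) \<and>
     H0map (TG U) (Tt U) f ` TD T \<subseteq> TD U \<and>
     (\<forall>C\<in>TD T. Tal U (H0map (TG U) (Tt U) f C) = Dmap p U f (Tal T C))}"

definition triso :: "nat \<Rightarrow> 'a ktriple \<Rightarrow> 'b ktriple \<Rightarrow> ('a \<Rightarrow> 'b) \<Rightarrow> bool" where
  "triso p T U f \<longleftrightarrow> f \<in> thoms p T U \<and>
     (\<exists>g\<in>thoms p U T. (\<forall>x\<in>carrier (TG T). g (f x) = x) \<and> (\<forall>y\<in>carrier (TG U). f (g y) = y))"

definition tilde :: "nat \<Rightarrow> 'a ktriple \<Rightarrow> 'a set" where
  "tilde p T = {x\<in>kerN p (TG T) (Tt T). imom (TG T) (Tt T) #>\<^bsub>TG T\<^esub> x \<in> TD T}"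

definition kt0 :: "('a, 'b, 'c) kmod \<Rightarrow> 'a \<Rightarrow> 'a" where
  "kt0 M = om (KG0 M) (a02 M \<circ> a20 M)"

definition PhiD :: "('a, 'b, 'c) kmod \<Rightarrow> 'a set set" where
  "PhiD M = (\<lambda>x. imom (KG0 M) (kt0 M) #>\<^bsub>KG0 M\<^esub> x) ` (a02 M ` carrier (KG2 M))"

definition Phi :: "nat \<Rightarrow> ('a, 'b, 'c) kmod \<Rightarrow> 'a ktriple" where
  "Phi p M = \<lparr> TG = KG0 M, Tgr = Kgr0 M, Tt = kt0 M, TD = PhiD M,
     Tal = (\<lambda>C. SOME Z. \<exists>x\<in>carrier (KG2 M). \<exists>y\<in>kerN p (KG0 M) (kt0 M).
              C = imom (KG0 M) (kt0 M) #>\<^bsub>KG0 M\<^esub> a02 M x \<and> a10 M y = a12 M x \<and>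
              Z = PhiD M #>\<^bsub>H0 p (KG0 M) (kt0 M)\<^esub> (imom (KG0 M) (kt0 M) #>\<^bsub>KG0 M\<^esub> y)) \<rparr>"

end

(* For an exact module with a21 = 0, a02 is injective and a10 is surjective with kernel
   W = a02(M_2), the preimage of the subspace in ker N(t). Hence M_2 is W and M_1 is M_0 / W up to
   isomorphism, and all structure maps except a12 are forced: a20 is 1 - t and a01 is induced by N(t).
   The remaining map a12 : W -> ker N(t) / W has kernel im(1 - t) and
   is surjective, so it amounts to the isomorphism carried by the triple.
   A morphism f_0 determines f_2 by restriction and f_1 by passing to quotients. *)
theory Submission
  imports Defs
begin

text \<open>The map \<open>Tal\<close> joins iterated quotients: its arguments are cosets of
  im(1-t), its values are sets of such cosets. The proof replaces it by the relation
  \<open>rel_al\<close> between elements of M_0 itself: x in the preimage W of the subspace is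
  related to y in ker N(t) if the class of x is sent to that of y. A morphism of triples is then a
  graded t-equivariant homomorphism that preserves a subgroup and a relation. For the triple of a
  module the relation says a10 y = a12 x' with x = a02 x'; for the module built from a triple it is
  the old relation, so the identity of M_0 is an isomorphism of triples.

  The conditions with N come from two facts. First, N(t)(1-t) = 1 - t^p, while for a module it
  equals a01 a10 a02 a20 = 0; hence t^p = 1. Second, a21 = 0 makes s_1 and s_2 identities, so N(s_1)
  and N(s_2) are multiplication by p; what remains is N(t) = p on M_0/W and N(t) = 0 on W, and both
  hold because W lies between im(1-t) and ker N(t). Likewise t is trivial on H_0, so p = N(t) = 0
  there and every subgroup of H_0 is a Z/p-vector subspace.\<close>

section \<open>Graded groups and endomorphisms\<close>

text \<open>Indexing the degrees by \<^typ>\<open>bool\<close> makes a grading reversal a negation.\<close>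

definition hpart :: "bool \<Rightarrow> 'a \<times> 'a \<Rightarrow> 'a" where
  "hpart i gr = (if i then snd gr else fst gr)"

lemma hpart_simps [simp]: "hpart False gr = fst gr" "hpart True gr = snd gr"
  by (auto simp: hpart_def)

lemma all_hpart: "(\<forall>i. P (hpart i gr) i) \<longleftrightarrow> P (fst gr) False \<and> P (snd gr) True"
  by (metis (full_types) hpart_simps)

text \<open>Two splittings ab = cd give (a - c) + (b - d) = 0 with differences of opposite degrees,
  so uniqueness reduces to the vanishing statement \<open>triv\<close>, which is easier to verify in
  a quotient.\<close>

lemma gradedI:
  assumes G: "comm_group G" and sub: "\<And>i. subgroup (hpart i gr) G"
    and split: "\<And>x. x \<in> carrier G \<Longrightarrow> \<exists>a\<in>fst gr. \<exists>b\<in>snd gr. x = a \<otimes>\<^bsub>G\<^esub> b"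
    and triv: "\<And>i a b. a \<in> hpart i gr \<Longrightarrow> b \<in> hpart (\<not> i) gr \<Longrightarrow> a \<otimes>\<^bsub>G\<^esub> b = \<one>\<^bsub>G\<^esub> \<Longrightarrow> a = \<one>\<^bsub>G\<^esub>"
  shows "graded G gr"
proof -
  interpret comm_group G by (rule G)
  interpret S0: subgroup "fst gr" G using sub[of False] by simp
  interpret S1: subgroup "snd gr" G using sub[of True] by simp
  have uniq: "a = c \<and> b = d" if "a \<in> fst gr" "b \<in> snd gr" "c \<in> fst gr" "d \<in> snd gr"
      "a \<otimes>\<^bsub>G\<^esub> b = c \<otimes>\<^bsub>G\<^esub> d" for a b c d
  proof -
    have carr: "a \<in> carrier G" "b \<in> carrier G" "c \<in> carrier G" "d \<in> carrier G"
      using that by auto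
    have "(a \<otimes>\<^bsub>G\<^esub> inv\<^bsub>G\<^esub> c) \<otimes>\<^bsub>G\<^esub> (b \<otimes>\<^bsub>G\<^esub> inv\<^bsub>G\<^esub> d) = (a \<otimes>\<^bsub>G\<^esub> b) \<otimes>\<^bsub>G\<^esub> inv\<^bsub>G\<^esub> (c \<otimes>\<^bsub>G\<^esub> d)"
      using carr by (simp add: inv_mult m_ac)
    also have "\<dots> = \<one>\<^bsub>G\<^esub>" using that carr by simp
    finally have "a \<otimes>\<^bsub>G\<^esub> inv\<^bsub>G\<^esub> c = \<one>\<^bsub>G\<^esub>"
      using triv[of "a \<otimes>\<^bsub>G\<^esub> inv\<^bsub>G\<^esub> c" False "b \<otimes>\<^bsub>G\<^esub> inv\<^bsub>G\<^esub> d"] that by simp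
    then have "a = c" using carr inv_equality[of a "inv\<^bsub>G\<^esub> c"] by simp
    with that carr show ?thesis by simp
  qed
  show ?thesis unfolding graded_def
  proof (intro conjI ballI)
    fix x assume "x \<in> carrier G"
    then obtain a b where ab: "a \<in> fst gr" "b \<in> snd gr" "x = a \<otimes>\<^bsub>G\<^esub> b" using split by blast
    show "\<exists>!ab. fst ab \<in> fst gr \<and> snd ab \<in> snd gr \<and> x = fst ab \<otimes>\<^bsub>G\<^esub> snd ab"
      by (rule ex1I[of _ "(a, b)"]) (use ab uniq in \<open>auto simp: prod_eq_iff\<close>)
  qed (use G sub[of False] sub[of True] in auto)
qed

lemma gradedD:
  assumes "graded G gr"
  shows "comm_group G" "subgroup (hpart i gr) G" "hpart i gr \<subseteq> carrier G"
proof -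
  show "comm_group G" "subgroup (hpart i gr) G"
    using assms by (auto simp: graded_def hpart_def)
  then show "hpart i gr \<subseteq> carrier G" by (simp add: subgroup.subset)
qed

lemma graded_split:
  assumes "graded G gr" "x \<in> carrier G"
  obtains a b where "a \<in> hpart i gr" "b \<in> hpart (\<not> i) gr" "x = a \<otimes>\<^bsub>G\<^esub> b"
proof -
  interpret comm_group G using assms gradedD by blast
  obtain a b where ab: "a \<in> fst gr" "b \<in> snd gr" "x = a \<otimes>\<^bsub>G\<^esub> b"
    using assms unfolding graded_def by blast
  show ?thesis
  proof (cases i)
    case True
    have "a \<in> carrier G" "b \<in> carrier G"
      using ab gradedD(3)[OF assms(1), of False] gradedD(3)[OF assms(1), of True] by auto
    then show ?thesis using that[of b a] ab True m_comm by auto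
  qed (use ab that in auto)
qed

lemma graded_unique:
  assumes "graded G gr" "a \<in> hpart i gr" "b \<in> hpart (\<not> i) gr" "c \<in> hpart i gr" "d \<in> hpart (\<not> i) gr"
    "a \<otimes>\<^bsub>G\<^esub> b = c \<otimes>\<^bsub>G\<^esub> d"
  shows "a = c \<and> b = d"
proof -
  interpret comm_group G using assms gradedD by blast
  have *: "a' = c' \<and> b' = d'" if "a' \<in> fst gr" "b' \<in> snd gr" "c' \<in> fst gr" "d' \<in> snd gr"
      "a' \<otimes>\<^bsub>G\<^esub> b' = c' \<otimes>\<^bsub>G\<^esub> d'" for a' b' c' d'
  proof -
    have "fst gr \<subseteq> carrier G" "snd gr \<subseteq> carrier G"
      using gradedD(3)[OF assms(1), of False] gradedD(3)[OF assms(1), of True] by auto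
    then have "a' \<otimes>\<^bsub>G\<^esub> b' \<in> carrier G" using that by auto
    then have ex: "\<exists>!ab. fst ab \<in> fst gr \<and> snd ab \<in> snd gr \<and> a' \<otimes>\<^bsub>G\<^esub> b' = fst ab \<otimes>\<^bsub>G\<^esub> snd ab"
      using assms(1) unfolding graded_def by blast
    have "(a', b') = (c', d')"
      by (rule ex1E[OF ex]) (metis that fst_conv snd_conv)
    then show ?thesis by simp
  qed
  have "a \<in> carrier G" "b \<in> carrier G" "c \<in> carrier G" "d \<in> carrier G"
    using assms gradedD(3) by blast+
  then show ?thesis
    using *[of a b c d] *[of b a d c] assms m_comm by (cases i) auto
qed

lemma graded_triv:
  assumes "graded G gr" "a \<in> hpart i gr" "b \<in> hpart (\<not> i) gr" "a \<otimes>\<^bsub>G\<^esub> b \<in> hpart i gr"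
  shows "b = \<one>\<^bsub>G\<^esub>"
proof -
  interpret comm_group G using assms gradedD by blast
  have "a \<in> carrier G" "b \<in> carrier G" "\<one>\<^bsub>G\<^esub> \<in> hpart (\<not> i) gr"
    using assms gradedD(3) gradedD(2)[OF assms(1), of "\<not> i"] subgroup.one_closed by blast+
  then show ?thesis
    using graded_unique[OF assms(1,2,3), of "a \<otimes>\<^bsub>G\<^esub> b" "\<one>\<^bsub>G\<^esub>"] assms by auto
qed

lemma gpres_iff: "gpres f G g H h \<longleftrightarrow> f \<in> hom G H \<and> (\<forall>i. f ` hpart i g \<subseteq> hpart i h)"
  unfolding gpres_def by (subst all_hpart[where P = "\<lambda>C i. f ` C \<subseteq> hpart i h"]) simp

lemma grev_iff: "grev f G g H h \<longleftrightarrow> f \<in> hom G H \<and> (\<forall>i. f ` hpart i g \<subseteq> hpart (\<not> i) h)"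
  unfolding grev_def by (subst all_hpart[where P = "\<lambda>C i. f ` C \<subseteq> hpart (\<not> i) h"]) simp

lemma gpres_hpart: "gpres f G g H h \<Longrightarrow> x \<in> hpart i g \<Longrightarrow> f x \<in> hpart i h"
  unfolding gpres_iff by blast

lemma grev_hpart: "grev f G g H h \<Longrightarrow> x \<in> hpart i g \<Longrightarrow> f x \<in> hpart (\<not> i) h"
  unfolding grev_iff by blast

text \<open>The component of x outside degree i has an image lying in both degrees, hence zero, so
  dropping it leaves f x unchanged. This gives homogeneous lifts along \<open>a10\<close> and, by
  injectivity, homogeneity of preimages under \<open>a02\<close>.\<close>

lemma homogeneous_preimage:
  assumes "graded G g" "graded H h" "gpres f G g H h" "x \<in> carrier G" "f x \<in> hpart i h"
  obtains a where "a \<in> hpart i g" "f a = f x"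
proof -
  interpret H: comm_group H using assms gradedD by blast
  obtain a b where ab: "a \<in> hpart i g" "b \<in> hpart (\<not> i) g" "x = a \<otimes>\<^bsub>G\<^esub> b"
    using graded_split[OF assms(1,4)] by blast
  have c: "a \<in> carrier G" "b \<in> carrier G" using ab gradedD(3)[OF assms(1)] by blast+
  have f: "f a \<in> hpart i h" "f b \<in> hpart (\<not> i) h"
    using assms(3) ab by (auto simp: gpres_iff)
  have fx: "f x = f a \<otimes>\<^bsub>H\<^esub> f b"
    using ab c assms(3) by (auto simp: gpres_iff hom_mult)
  then have "f b = \<one>\<^bsub>H\<^esub>" using graded_triv[OF assms(2) f] assms(5) by simp
  moreover have "f a \<in> carrier H" using f gradedD(3)[OF assms(2)] by blast
  ultimately show ?thesis using that[of a] ab fx by simp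
qed

section \<open>Gradings on homogeneous subgroups and on quotients by them\<close>

definition graded_subset :: "'a monoid \<Rightarrow> 'a set \<times> 'a set \<Rightarrow> 'a set \<Rightarrow> bool" where
  "graded_subset G gr W \<longleftrightarrow> (\<forall>x\<in>W. \<exists>a\<in>W \<inter> fst gr. \<exists>b\<in>W \<inter> snd gr. x = a \<otimes>\<^bsub>G\<^esub> b)"

lemma hpart_qgr: "hpart i (qgr G W gr) = (\<lambda>a. W #>\<^bsub>G\<^esub> a) ` hpart i gr"
  by (auto simp: hpart_def qgr_def)

lemma hpart_Int: "hpart i (fst gr \<inter> W, snd gr \<inter> W) = hpart i gr \<inter> W"
  by (auto simp: hpart_def)

text \<open>The definitions of gradings take \<open>'a monoid\<close>, whereas \<^locale>\<open>comm_group\<close> allows record extensions.\<close>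

locale plain_comm_group = comm_group G for G :: "'a monoid" (structure)

lemma plain_comm_groupI: "comm_group G \<Longrightarrow> plain_comm_group G"
  by (simp add: plain_comm_group_def)

lemma (in plain_comm_group) subgroup_comm_group:
  assumes "subgroup H G"
  shows "comm_group (G\<lparr>carrier := H\<rparr>)"
proof -
  interpret H: group "G\<lparr>carrier := H\<rparr>" by (rule subgroup.subgroup_is_group[OF assms is_group])
  show ?thesis
    using subgroup.mem_carrier[OF assms] by (intro H.group_comm_groupI) (simp add: m_comm)
qed

lemma (in plain_comm_group) graded_subgroup:
  assumes "graded G gr" "subgroup W G" "graded_subset G gr W"
  shows "graded (G\<lparr>carrier := W\<rparr>) (fst gr \<inter> W, snd gr \<inter> W)"
proof (rule gradedI)
  show "comm_group (G\<lparr>carrier := W\<rparr>)" by (rule subgroup_comm_group[OF assms(2)])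
next
  fix i
  show "subgroup (hpart i (fst gr \<inter> W, snd gr \<inter> W)) (G\<lparr>carrier := W\<rparr>)"
    unfolding hpart_Int
    by (intro subgroup_incl subgroups_Inter_pair gradedD(2)[OF assms(1)] assms(2)) auto
next
  fix x assume "x \<in> carrier (G\<lparr>carrier := W\<rparr>)"
  then show "\<exists>a\<in>fst (fst gr \<inter> W, snd gr \<inter> W). \<exists>b\<in>snd (fst gr \<inter> W, snd gr \<inter> W).
      x = a \<otimes>\<^bsub>G\<lparr>carrier := W\<rparr>\<^esub> b"
    using assms(3) unfolding graded_subset_def by fastforce
next
  fix i a b assume "a \<in> hpart i (fst gr \<inter> W, snd gr \<inter> W)" "b \<in> hpart (\<not> i) (fst gr \<inter> W, snd gr \<inter> W)"
    "a \<otimes>\<^bsub>G\<lparr>carrier := W\<rparr>\<^esub> b = \<one>\<^bsub>G\<lparr>carrier := W\<rparr>\<^esub>"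
  then have ab: "a \<in> hpart i gr" "b \<in> hpart (\<not> i) gr" "a \<otimes> b = \<one>"
    unfolding hpart_Int by auto
  have c: "a \<in> carrier G" "b \<in> carrier G"
    using ab gradedD(3)[OF assms(1)] by blast+
  have "b \<otimes> a \<in> hpart (\<not> i) gr"
    using ab c gradedD(2)[OF assms(1), of "\<not> i"] by (simp add: m_comm subgroup.one_closed)
  then show "a = \<one>\<^bsub>G\<lparr>carrier := W\<rparr>\<^esub>"
    using graded_triv[OF assms(1), of b "\<not> i" a] ab by simp
qed

lemma (in plain_comm_group) rcos_eq_iff:
  assumes "subgroup H G" "x \<in> carrier G" "y \<in> carrier G"
  shows "H #> x = H #> y \<longleftrightarrow> x \<otimes> inv y \<in> H"
proof
  assume "H #> x = H #> y"
  then have "x \<in> H #> y" using rcos_self[OF assms(2,1)] by simp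
  then show "x \<otimes> inv y \<in> H" using subgroup.rcos_module_imp[OF assms(1) is_group assms(3)] by simp
next
  assume "x \<otimes> inv y \<in> H"
  then have "x \<in> H #> y"
    by (rule subgroup.rcos_module_rev[OF assms(1) is_group assms(3,2)])
  then show "H #> x = H #> y"
    using repr_independence[OF _ assms(3,1), of x] by simp
qed

lemma (in plain_comm_group) rcos_hom:
  assumes "subgroup H G"
  shows "(\<lambda>x. H #> x) \<in> hom G (G Mod H)"
  using assms by (simp add: normal.r_coset_hom_Mod normal_iff_subgroup)

text \<open>Homogeneity of W is what keeps the sum direct: if a + b lies in W with a and b of
  opposite degrees, then a + b is also a sum of homogeneous elements of W, and uniqueness in G
  identifies a with one of them.\<close>

lemma (in plain_comm_group) graded_quotient:
  assumes gr: "graded G gr" and W: "subgroup W G" "graded_subset G gr W"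
  shows "graded (G Mod W) (qgr G W gr)"
proof (rule gradedI)
  show "comm_group (G Mod W)" by (rule abelian_FactGroup[OF W(1)])
  then interpret Q: comm_group "G Mod W" .
  interpret q: group_hom G "G Mod W" "\<lambda>x. W #> x"
    by unfold_locales (rule rcos_hom[OF W(1)])
  have mult: "(W #> x) \<otimes>\<^bsub>G Mod W\<^esub> (W #> y) = W #> (x \<otimes> y)" if "x \<in> carrier G" "y \<in> carrier G" for x y
    using that by simp
  show "subgroup (hpart i (qgr G W gr)) (G Mod W)" for i
    unfolding hpart_qgr by (rule q.subgroup_img_is_subgroup[OF gradedD(2)[OF gr]])
  show "\<exists>a\<in>fst (qgr G W gr). \<exists>b\<in>snd (qgr G W gr). C = a \<otimes>\<^bsub>G Mod W\<^esub> b"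
    if C: "C \<in> carrier (G Mod W)" for C
  proof -
    obtain x where x: "x \<in> carrier G" "C = W #> x" using C by (auto simp: FactGroup_def RCOSETS_def)
    obtain a b where ab: "a \<in> hpart False gr" "b \<in> hpart (\<not> False) gr" "x = a \<otimes> b"
      using graded_split[OF gr x(1)] by blast
    then have "a \<in> carrier G" "b \<in> carrier G" using gradedD(3)[OF gr] by blast+
    then have "C = (W #> a) \<otimes>\<^bsub>G Mod W\<^esub> (W #> b)" using x ab mult by simp
    then show ?thesis using ab by (auto simp: qgr_def)
  qed
  show "C = \<one>\<^bsub>G Mod W\<^esub>" if CD: "C \<in> hpart i (qgr G W gr)" "D \<in> hpart (\<not> i) (qgr G W gr)"
      "C \<otimes>\<^bsub>G Mod W\<^esub> D = \<one>\<^bsub>G Mod W\<^esub>" for i C D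
  proof -
    obtain a b where ab: "a \<in> hpart i gr" "C = W #> a" "b \<in> hpart (\<not> i) gr" "D = W #> b"
      using CD by (auto simp: hpart_qgr)
    then have c: "a \<in> carrier G" "b \<in> carrier G" using gradedD(3)[OF gr] by blast+
    have "W #> (a \<otimes> b) = \<one>\<^bsub>G Mod W\<^esub>" using CD(3) ab mult[OF c] by simp
    then have "W #> (a \<otimes> b) = W #> \<one>" by simp
    then have "a \<otimes> b \<in> W" using rcos_eq_iff[OF W(1), of "a \<otimes> b" \<one>] c by simp
    then obtain d e where de: "d \<in> W \<inter> fst gr" "e \<in> W \<inter> snd gr" "a \<otimes> b = d \<otimes> e"
      using W(2) unfolding graded_subset_def by blast
    have dec: "d \<in> carrier G" "e \<in> carrier G" using de subgroup.subset[OF W(1)] by auto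
    have "a \<in> W"
      using graded_unique[OF gr ab(1,3), of d e] graded_unique[OF gr ab(1,3), of e d] de dec m_comm
      by (cases i) auto
    then have "W #> a = W" using W(1) c by (simp add: subgroup.rcos_const)
    then show ?thesis using ab by simp
  qed
qed

section \<open>An endomorphism t and the operators 1 - t and N(t)\<close>

locale endo = plain_comm_group +
  fixes t :: "'a \<Rightarrow> 'a"
  assumes t_hom: "t \<in> hom G G"
begin

lemma t_closed [simp]: "x \<in> carrier G \<Longrightarrow> t x \<in> carrier G"
  using t_hom by (rule hom_in_carrier)

lemma t_mult: "x \<in> carrier G \<Longrightarrow> y \<in> carrier G \<Longrightarrow> t (x \<otimes> y) = t x \<otimes> t y"
  using t_hom by (rule hom_mult)

lemma t_inv: "x \<in> carrier G \<Longrightarrow> t (inv x) = inv (t x)"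
  using t_hom group_hom.hom_inv[of G G t] by (simp add: group_hom_def group_hom_axioms_def)

lemma funpow_closed [simp]: "x \<in> carrier G \<Longrightarrow> (t ^^ n) x \<in> carrier G"
  by (induction n) auto

lemma funpow_mult: "x \<in> carrier G \<Longrightarrow> y \<in> carrier G \<Longrightarrow> (t ^^ n) (x \<otimes> y) = (t ^^ n) x \<otimes> (t ^^ n) y"
  by (induction n) (auto simp: t_mult)

lemma om_closed [simp]: "x \<in> carrier G \<Longrightarrow> om G t x \<in> carrier G"
  by (simp add: om_def)

lemma om_hom: "om G t \<in> hom G G"
  by (rule homI) (auto simp: om_def t_mult inv_mult m_ac)

lemma Nop_0 [simp]: "Nop 0 G t x = \<one>"
  by (simp add: Nop_def)

lemma Nop_Suc: "x \<in> carrier G \<Longrightarrow> Nop (Suc n) G t x = (t ^^ n) x \<otimes> Nop n G t x"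
  by (simp add: Nop_def lessThan_Suc)

lemma Nop_closed [simp]: "x \<in> carrier G \<Longrightarrow> Nop n G t x \<in> carrier G"
  by (simp add: Nop_def)

lemma Nop_hom: "Nop n G t \<in> hom G G"
proof (rule homI)
  show "Nop n G t (x \<otimes> y) = Nop n G t x \<otimes> Nop n G t y" if "x \<in> carrier G" "y \<in> carrier G" for x y
    using that by (induction n) (auto simp: Nop_Suc funpow_mult m_ac)
qed simp

text \<open>The telescoping identity (1 + t + ... + t^(n-1))(1 - t) = 1 - t^n.\<close>

lemma Nop_om: "x \<in> carrier G \<Longrightarrow> Nop n G t (om G t x) = x \<otimes> inv ((t ^^ n) x)"
proof (induction n)
  case (Suc n)
  have "(t ^^ n) (om G t x) = (t ^^ n) x \<otimes> (t ^^ n) (inv (t x))"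
    using Suc.prems by (simp add: om_def funpow_mult)
  also have "(t ^^ n) (inv (t x)) = inv ((t ^^ Suc n) x)"
  proof (induction n)
    case (Suc m) then show ?case using \<open>x \<in> carrier G\<close> by (simp add: t_inv)
  qed simp
  finally have "Nop (Suc n) G t (om G t x) = (t ^^ n) x \<otimes> inv ((t ^^ Suc n) x) \<otimes> (x \<otimes> inv ((t ^^ n) x))"
    using Suc by (simp add: Nop_Suc)
  also have "\<dots> = x \<otimes> inv ((t ^^ Suc n) x) \<otimes> ((t ^^ n) x \<otimes> inv ((t ^^ n) x))"
    using Suc.prems funpow_closed[OF Suc.prems, of "Suc n"] funpow_closed[OF Suc.prems, of n]
    by (simp only: m_ac inv_closed m_closed)
  also have "\<dots> = x \<otimes> inv ((t ^^ Suc n) x)"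
    using Suc.prems by simp
  finally show ?case .
qed simp

end

text \<open>Naturality of N in the group with endomorphism. It serves for morphisms, for the
  inclusion of a subgroup, for the projection to a quotient, and for the identity between two maps
  that agree on the carrier.\<close>

lemma hom_Nop:
  assumes "endo G t" "endo H u" "h \<in> hom G H"
    and comm: "\<And>x. x \<in> carrier G \<Longrightarrow> h (t x) = u (h x)" and x: "x \<in> carrier G"
  shows "h (Nop n G t x) = Nop n H u (h x)"
proof -
  interpret G: endo G t by fact
  interpret H: endo H u by fact
  interpret h: group_hom G H h by unfold_locales fact
  have pow: "h ((t ^^ n) x) = (u ^^ n) (h x)" for n
    using x by (induction n) (auto simp: comm)
  show ?thesis
    using x by (induction n) (auto simp: pow G.Nop_Suc H.Nop_Suc)
qed

lemma (in plain_comm_group) endo_id: "(\<And>x. x \<in> carrier G \<Longrightarrow> t x = x) \<Longrightarrow> endo G t"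
  by unfold_locales (auto intro!: homI)

text \<open>N(1) = n. This evaluates N(s_1) and N(s_2) once \<open>a21\<close> vanishes.\<close>

lemma (in plain_comm_group) Nop_id:
  assumes t: "\<And>x. x \<in> carrier G \<Longrightarrow> t x = x" and x: "x \<in> carrier G"
  shows "Nop n G t x = x [^] n"
proof -
  interpret endo G t by (rule endo_id) (rule t)
  have "(t ^^ n) x = x" for n using x t by (induction n) auto
  then show ?thesis using x by (induction n) (auto simp: Nop_Suc m_comm)
qed

context endo begin

lemma imom_subgroup: "subgroup (imom G t) G"
  unfolding imom_def
  by (rule group_hom.img_is_subgroup) (use om_hom in \<open>simp add: group_hom_def group_hom_axioms_def\<close>)

lemma kerN_subgroup: "subgroup (kerN n G t) G"
proof -
  have "kerN n G t = kernel G G (Nop n G t)" by (auto simp: kerN_def kernel_def)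
  then show ?thesis using Nop_hom group_hom.subgroup_kernel[of G G "Nop n G t"]
    by (simp add: group_hom_def group_hom_axioms_def)
qed

end

section \<open>The group \<open>H\<^sub>0\<close> and morphisms of triples\<close>

abbreviation hcls :: "'a monoid \<Rightarrow> ('a \<Rightarrow> 'a) \<Rightarrow> 'a \<Rightarrow> 'a set" where
  "hcls G t x \<equiv> imom G t #>\<^bsub>G\<^esub> x"

abbreviation dcls :: "nat \<Rightarrow> 'a monoid \<Rightarrow> ('a \<Rightarrow> 'a) \<Rightarrow> 'a set set \<Rightarrow> 'a \<Rightarrow> 'a set set" where
  "dcls p G t D x \<equiv> D #>\<^bsub>H0 p G t\<^esub> hcls G t x"

locale cyclic_action = endo +
  fixes p :: nat
  assumes funpow_order: "x \<in> carrier G \<Longrightarrow> (t ^^ p) x = x"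
begin

text \<open>N(t)(1 - t) = 1 - t^p = 0, so the quotient H_0 makes sense.\<close>

lemma imom_subset_kerN: "imom G t \<subseteq> kerN p G t"
  by (auto simp: imom_def kerN_def Nop_om funpow_order)

lemma kerN_closed: "x \<in> kerN p G t \<Longrightarrow> x \<in> carrier G"
  by (simp add: kerN_def)

lemma imom_subgroup_kerN: "subgroup (imom G t) (G\<lparr>carrier := kerN p G t\<rparr>)"
  by (rule subgroup_incl[OF imom_subgroup kerN_subgroup imom_subset_kerN])

sublocale kerN: plain_comm_group "G\<lparr>carrier := kerN p G t\<rparr>"
  by (rule plain_comm_groupI[OF subgroup_comm_group[OF kerN_subgroup]])

sublocale H0: plain_comm_group "H0 p G t"
  unfolding H0_def by (rule plain_comm_groupI[OF kerN.abelian_FactGroup[OF imom_subgroup_kerN]])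

text \<open>Cosets depend on the multiplication only, not on the carrier, so classes in H_0 can be
  written as cosets in G.\<close>

lemma r_coset_kerN: "r_coset (G\<lparr>carrier := kerN p G t\<rparr>) S x = S #> x"
  by (simp add: r_coset_def)

lemma hcls_hom: "hcls G t \<in> hom (G\<lparr>carrier := kerN p G t\<rparr>) (H0 p G t)"
  using kerN.rcos_hom[OF imom_subgroup_kerN] by (simp add: H0_def r_coset_kerN)

lemma carrier_H0: "carrier (H0 p G t) = hcls G t ` kerN p G t"
  by (auto simp: H0_def FactGroup_def RCOSETS_def r_coset_kerN)

lemma hcls_mult:
  "x \<in> kerN p G t \<Longrightarrow> y \<in> kerN p G t \<Longrightarrow> hcls G t x \<otimes>\<^bsub>H0 p G t\<^esub> hcls G t y = hcls G t (x \<otimes> y)"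
  using hom_mult[OF hcls_hom] by simp

lemma hcls_eq_iff:
  "x \<in> carrier G \<Longrightarrow> y \<in> carrier G \<Longrightarrow> hcls G t x = hcls G t y \<longleftrightarrow> x \<otimes> inv y \<in> imom G t"
  by (rule rcos_eq_iff[OF imom_subgroup])

lemma hcls_group_hom: "group_hom (G\<lparr>carrier := kerN p G t\<rparr>) (H0 p G t) (hcls G t)"
  using hcls_hom by (simp add: group_hom_def group_hom_axioms_def kerN.is_group H0.is_group)

text \<open>The correspondence theorem, from subgroups of H_0 to subgroups of G between im(1-t) and
  ker N(t).\<close>

lemma subgroup_preimage_H0:
  assumes D: "subgroup D (H0 p G t)"
  defines "W \<equiv> {x \<in> kerN p G t. hcls G t x \<in> D}"
  shows "subgroup W G" "imom G t \<subseteq> W" "W \<subseteq> kerN p G t" "hcls G t ` W = D"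
proof -
  interpret D: subgroup D "H0 p G t" by (rule D)
  interpret K: subgroup "kerN p G t" G by (rule kerN_subgroup)
  interpret h: group_hom "G\<lparr>carrier := kerN p G t\<rparr>" "H0 p G t" "hcls G t" by (rule hcls_group_hom)
  show "W \<subseteq> kerN p G t" by (auto simp: W_def)
  show "hcls G t ` W = D"
    using D.subset by (auto simp: W_def carrier_H0)
  show "imom G t \<subseteq> W"
  proof
    fix x assume x: "x \<in> imom G t"
    then have xc: "x \<in> kerN p G t" using imom_subset_kerN by auto
    have "hcls G t x = hcls G t \<one>" using x xc by (subst hcls_eq_iff) auto
    also have "\<dots> \<in> D" using h.hom_one D.one_closed by simp
    finally show "x \<in> W" using xc by (simp add: W_def)
  qed
  show "subgroup W G"
  proof (rule subgroupI)
    show "W \<subseteq> carrier G" by (auto simp: W_def)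
    show "W \<noteq> {}"
      using \<open>imom G t \<subseteq> W\<close> subgroup.one_closed[OF imom_subgroup] by blast
    show "inv x \<in> W" if "x \<in> W" for x
    proof -
      have x: "x \<in> kerN p G t" "hcls G t x \<in> D" using that by (auto simp: W_def)
      have "hcls G t (inv x) = inv\<^bsub>H0 p G t\<^esub> (hcls G t x)"
        using h.hom_inv[of x] x m_inv_consistent[OF kerN_subgroup] by simp
      then show ?thesis using x by (simp add: W_def)
    qed
    show "x \<otimes> y \<in> W" if "x \<in> W" "y \<in> W" for x y
      using that by (auto simp: W_def hcls_mult[symmetric])
  qed
qed

end

text \<open>The other direction of the correspondence, starting from the subgroup W of G. It is
  instantiated by \<open>tilde p T\<close> for a triple and by the image of \<open>a02\<close> for a
  module, so both share the calculus of classes below.\<close>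

locale cyclic_pair = cyclic_action +
  fixes W :: "'a set"
  assumes W_subgroup: "subgroup W G" and imom_subset_W: "imom G t \<subseteq> W"
    and W_subset_kerN: "W \<subseteq> kerN p G t"
begin

abbreviation D :: "'a set set" where "D \<equiv> hcls G t ` W"

lemma W_closed: "x \<in> W \<Longrightarrow> x \<in> carrier G"
  using W_subgroup by (rule subgroup.mem_carrier)

lemma D_subgroup: "subgroup D (H0 p G t)"
  by (rule group_hom.subgroup_img_is_subgroup[OF hcls_group_hom])
    (rule subgroup_incl[OF W_subgroup kerN_subgroup W_subset_kerN])

text \<open>W contains im(1-t), hence is a union of classes.\<close>

lemma hcls_mem_D_iff: "x \<in> carrier G \<Longrightarrow> hcls G t x \<in> D \<longleftrightarrow> x \<in> W"
proof
  assume x: "x \<in> carrier G" "hcls G t x \<in> D"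
  then obtain w where w: "w \<in> W" "hcls G t x = hcls G t w" by auto
  then have "x \<otimes> inv w \<in> W" using x hcls_eq_iff W_closed imom_subset_W by blast
  then have "x \<otimes> inv w \<otimes> w \<in> W" using w W_subgroup subgroup.m_closed by fast
  then show "x \<in> W" using x w W_closed by (simp add: m_assoc)
qed auto

lemma preimage_D: "{x \<in> kerN p G t. hcls G t x \<in> D} = W"
  using hcls_mem_D_iff W_subset_kerN kerN_closed by auto

lemma dcls_alt:
  assumes "y \<in> kerN p G t"
  shows "dcls p G t D y = (\<lambda>w. hcls G t (w \<otimes> y)) ` W"
proof -
  have "dcls p G t D y = (\<lambda>w. hcls G t w \<otimes>\<^bsub>H0 p G t\<^esub> hcls G t y) ` W"
    unfolding r_coset_def[of "H0 p G t" D] by blast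
  also have "\<dots> = (\<lambda>w. hcls G t (w \<otimes> y)) ` W"
    using assms W_subset_kerN by (intro image_cong hcls_mult) auto
  finally show ?thesis .
qed

text \<open>The third isomorphism theorem on elements: (ker N(t)/im(1-t)) / (W/im(1-t)) is ker
  N(t)/W.\<close>

lemma dcls_eq_iff:
  assumes "x \<in> kerN p G t" "y \<in> kerN p G t"
  shows "dcls p G t D x = dcls p G t D y \<longleftrightarrow> x \<otimes> inv y \<in> W"
proof -
  interpret K: subgroup "kerN p G t" G by (rule kerN_subgroup)
  interpret h: group_hom "G\<lparr>carrier := kerN p G t\<rparr>" "H0 p G t" "hcls G t" by (rule hcls_group_hom)
  have "dcls p G t D x = dcls p G t D y \<longleftrightarrow>
      hcls G t x \<otimes>\<^bsub>H0 p G t\<^esub> inv\<^bsub>H0 p G t\<^esub> (hcls G t y) \<in> D"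
    using assms by (intro H0.rcos_eq_iff[OF D_subgroup]) (auto simp: carrier_H0)
  also have "inv\<^bsub>H0 p G t\<^esub> (hcls G t y) = hcls G t (inv y)"
    using h.hom_inv[of y] assms m_inv_consistent[OF kerN_subgroup] by simp
  finally show ?thesis using assms hcls_mem_D_iff kerN_closed by (simp add: hcls_mult)
qed

lemma dcls_hom: "dcls p G t D \<in> hom (G\<lparr>carrier := kerN p G t\<rparr>) (H0 p G t Mod D)"
  using Group.hom_compose[OF hcls_hom H0.rcos_hom[OF D_subgroup]] by (simp add: o_def)

lemma dcls_mult:
  "x \<in> kerN p G t \<Longrightarrow> y \<in> kerN p G t \<Longrightarrow>
    dcls p G t D x \<otimes>\<^bsub>H0 p G t Mod D\<^esub> dcls p G t D y = dcls p G t D (x \<otimes> y)"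
  using hom_mult[OF dcls_hom] by simp

lemma carrier_H0_Mod: "carrier (H0 p G t Mod D) = dcls p G t D ` kerN p G t"
  by (auto simp: FactGroup_def RCOSETS_def carrier_H0)

text \<open>Flattening an iterated coset makes the third isomorphism theorem explicit: the summand
  from im(1-t) is absorbed by W.\<close>

lemma Union_dcls:
  assumes "y \<in> kerN p G t"
  shows "\<Union> (dcls p G t D y) = W #> y"
proof -
  have y: "y \<in> carrier G" using assms kerN_closed by simp
  have "\<Union> (dcls p G t D y) = (\<Union>w\<in>W. \<Union>i\<in>imom G t. {i \<otimes> (w \<otimes> y)})"
    unfolding dcls_alt[OF assms] unfolding r_coset_def[of G "imom G t"] by blast
  also have "\<dots> = (\<Union>w\<in>W. {w \<otimes> y})"
  proof (intro subset_antisym subsetI)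
    fix z assume "z \<in> (\<Union>w\<in>W. \<Union>i\<in>imom G t. {i \<otimes> (w \<otimes> y)})"
    then obtain w i where wi: "w \<in> W" "i \<in> W" "z = i \<otimes> (w \<otimes> y)" using imom_subset_W by auto
    then have "z = (i \<otimes> w) \<otimes> y" using W_closed y by (simp add: m_assoc)
    then show "z \<in> (\<Union>w\<in>W. {w \<otimes> y})" using wi subgroup.m_closed[OF W_subgroup] by blast
  next
    fix z assume "z \<in> (\<Union>w\<in>W. {w \<otimes> y})"
    then obtain w where w: "w \<in> W" "z = w \<otimes> y" by auto
    then have "z = \<one> \<otimes> (w \<otimes> y)" using W_closed y by simp
    then show "z \<in> (\<Union>w\<in>W. \<Union>i\<in>imom G t. {i \<otimes> (w \<otimes> y)})"
      using w subgroup.one_closed[OF imom_subgroup] by blast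
  qed
  finally show ?thesis by (simp add: r_coset_def)
qed

end

text \<open>These assumptions suffice to read \<open>Tal\<close> on representatives. They are
  separated from \<open>valid_triple\<close> because \<open>Phi p M\<close> is handled through this
  reading before its validity is established.\<close>

locale pretriple = cyclic_action "TG T" "Tt T" p for p :: nat and T :: "'a ktriple" +
  assumes TD_subgroup: "subgroup (TD T) (TH0 p T)"
    and Tal_carrier: "C \<in> TD T \<Longrightarrow> Tal T C \<in> carrier (TH0 p T Mod TD T)"
begin

lemma tilde_eq: "tilde p T = {x \<in> kerN p (TG T) (Tt T). hcls (TG T) (Tt T) x \<in> TD T}"
  by (simp add: tilde_def)

sublocale cyclic_pair "TG T" "Tt T" p "tilde p T"
  unfolding tilde_eq
  by (intro cyclic_pair.intro cyclic_pair_axioms.intro cyclic_action_axioms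
      subgroup_preimage_H0[OF TD_subgroup])

lemma TD_eq: "hcls (TG T) (Tt T) ` tilde p T = TD T"
  unfolding tilde_eq by (rule subgroup_preimage_H0[OF TD_subgroup])

lemma Tal_dcls:
  assumes "x \<in> tilde p T"
  obtains y where "y \<in> kerN p (TG T) (Tt T)"
    "Tal T (hcls (TG T) (Tt T) x) = dcls p (TG T) (Tt T) (TD T) y"
  using Tal_carrier[of "hcls (TG T) (Tt T) x"] assms carrier_H0_Mod
  unfolding TD_eq by (auto simp: tilde_def)

end

text \<open>The isomorphism of a triple, read as a relation on representatives in the group itself.\<close>

definition rel_al :: "nat \<Rightarrow> 'a ktriple \<Rightarrow> 'a \<Rightarrow> 'a \<Rightarrow> bool" where
  "rel_al p T x y \<longleftrightarrow> x \<in> tilde p T \<and> y \<in> kerN p (TG T) (Tt T) \<and>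
     Tal T (hcls (TG T) (Tt T) x) = dcls p (TG T) (Tt T) (TD T) y"

definition equivariant :: "('a \<Rightarrow> 'b) \<Rightarrow> 'a ktriple \<Rightarrow> 'b ktriple \<Rightarrow> bool" where
  "equivariant f T U \<longleftrightarrow> f \<in> hom (TG T) (TG U) \<and> (\<forall>x\<in>carrier (TG T). f (Tt T x) = Tt U (f x))"

lemma equivariant_kerN:
  assumes "pretriple p T" "pretriple p U" "equivariant f T U" "x \<in> kerN p (TG T) (Tt T)"
  shows "f x \<in> kerN p (TG U) (Tt U)"
proof -
  interpret T: pretriple p T by fact
  interpret U: pretriple p U by fact
  interpret f: group_hom "TG T" "TG U" f
    using assms(3) by unfold_locales (simp add: equivariant_def)
  have "f (Nop p (TG T) (Tt T) x) = Nop p (TG U) (Tt U) (f x)"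
    using assms by (intro hom_Nop[OF T.endo_axioms U.endo_axioms]) (auto simp: equivariant_def kerN_def)
  then show ?thesis using assms(4) by (auto simp: kerN_def)
qed

text \<open>\<open>H0map\<close> is a union over all representatives. Equivariance sends im(1-t)
  into im(1-t), so every representative contributes the same class.\<close>

lemma H0map_hcls:
  assumes "pretriple p T" "pretriple p U" "equivariant f T U" "x \<in> carrier (TG T)"
  shows "H0map (TG U) (Tt U) f (hcls (TG T) (Tt T) x) = hcls (TG U) (Tt U) (f x)"
proof -
  interpret T: pretriple p T by fact
  interpret U: pretriple p U by fact
  interpret f: group_hom "TG T" "TG U" f
    using assms(3) by unfold_locales (simp add: equivariant_def)
  have "hcls (TG U) (Tt U) (f z) = hcls (TG U) (Tt U) (f x)" if z: "z \<in> hcls (TG T) (Tt T) x" for z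
  proof -
    obtain u where u: "u \<in> carrier (TG T)" "z = om (TG T) (Tt T) u \<otimes>\<^bsub>TG T\<^esub> x"
      using z by (auto simp: r_coset_def imom_def)
    have "f (om (TG T) (Tt T) u) = om (TG U) (Tt U) (f u)"
      using assms(3) u by (simp add: equivariant_def om_def)
    then have "f z = om (TG U) (Tt U) (f u) \<otimes>\<^bsub>TG U\<^esub> f x"
      using u assms(4) by simp
    then have "f z \<otimes>\<^bsub>TG U\<^esub> inv\<^bsub>TG U\<^esub> (f x) = om (TG U) (Tt U) (f u)"
      using u assms(4) by (simp add: U.m_assoc)
    then show ?thesis using u assms(4) by (subst U.hcls_eq_iff) (auto simp: imom_def)
  qed
  moreover have "x \<in> hcls (TG T) (Tt T) x"
    using T.rcos_self[OF assms(4) T.imom_subgroup] .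
  ultimately show ?thesis unfolding H0map_def by blast
qed

text \<open>The same argument one quotient further up: changing y by w in \<open>tilde p T\<close>
  changes f y by f w, which lies in \<open>tilde p U\<close>.\<close>

lemma Dmap_dcls:
  assumes "pretriple p T" "pretriple p U" "equivariant f T U" "f ` tilde p T \<subseteq> tilde p U"
    and y: "y \<in> kerN p (TG T) (Tt T)"
  shows "Dmap p U f (dcls p (TG T) (Tt T) (TD T) y) = dcls p (TG U) (Tt U) (TD U) (f y)"
proof -
  interpret T: pretriple p T by fact
  interpret U: pretriple p U by fact
  interpret f: group_hom "TG T" "TG U" f
    using assms(3) by unfold_locales (simp add: equivariant_def)
  have yc: "y \<in> carrier (TG T)" using y T.kerN_closed by simp
  have *: "r_coset (TH0 p U) (TD U) (H0map (TG U) (Tt U) f (hcls (TG T) (Tt T) (w \<otimes>\<^bsub>TG T\<^esub> y))) =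
      dcls p (TG U) (Tt U) (TD U) (f y)" if w: "w \<in> tilde p T" for w
  proof -
    have wc: "w \<in> carrier (TG T)" using w T.W_closed by simp
    have fw: "f w \<in> tilde p U" using w assms(4) by auto
    have k: "f y \<in> kerN p (TG U) (Tt U)" "f w \<in> kerN p (TG U) (Tt U)"
      using equivariant_kerN[OF assms(1,2,3)] y w T.W_subset_kerN by auto
    then have k2: "f w \<otimes>\<^bsub>TG U\<^esub> f y \<in> kerN p (TG U) (Tt U)"
      using U.kerN_subgroup by (simp add: subgroup.m_closed)
    have "f w \<otimes>\<^bsub>TG U\<^esub> f y \<otimes>\<^bsub>TG U\<^esub> inv\<^bsub>TG U\<^esub> (f y) \<in> tilde p U"
      using fw wc yc by (simp add: U.m_assoc)
    then have "dcls p (TG U) (Tt U) (TD U) (f w \<otimes>\<^bsub>TG U\<^esub> f y) = dcls p (TG U) (Tt U) (TD U) (f y)"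
      using U.dcls_eq_iff[OF k2 k(1)] unfolding U.TD_eq by simp
    then show ?thesis
      using wc yc by (simp add: H0map_hcls[OF assms(1,2,3)])
  qed
  \<comment> \<open>The union over a constant family equals that constant only if the index set is
    nonempty.\<close>
  have "\<one>\<^bsub>TG T\<^esub> \<in> tilde p T" using T.W_subgroup subgroup.one_closed by blast
  then show ?thesis
    unfolding Dmap_def T.dcls_alt[OF y, unfolded T.TD_eq] image_image using * by (simp add: cong: SUP_cong) blast
qed

text \<open>Both conditions on H_0 pass to representatives: the one on the subspaces through
  \<open>H0map_hcls\<close>, the intertwining of the isomorphisms through \<open>Dmap_dcls\<close>.
  From here on morphisms are handled without cosets.\<close>

lemma thoms_iff:
  assumes "pretriple p T" "pretriple p U"
  shows "f \<in> thoms p T U \<longleftrightarrow> gpres f (TG T) (Tgr T) (TG U) (Tgr U) \<and> f \<in> extensional (carrier (TG T)) \<and>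
    (\<forall>x\<in>carrier (TG T). f (Tt T x) = Tt U (f x)) \<and> f ` tilde p T \<subseteq> tilde p U \<and>
    (\<forall>x y. rel_al p T x y \<longrightarrow> rel_al p U (f x) (f y))"
\<comment> \<open>Both sides contain these two conditions, and they give the equivariance under
  which \<open>H0map\<close> and \<open>Dmap\<close> can be computed on representatives.\<close>
proof (cases "gpres f (TG T) (Tgr T) (TG U) (Tgr U) \<and> (\<forall>x\<in>carrier (TG T). f (Tt T x) = Tt U (f x))")
  case False
  then show ?thesis by (auto simp: thoms_def)
next
  case True
  interpret T: pretriple p T by fact
  interpret U: pretriple p U by fact
  have eq: "equivariant f T U" using True by (auto simp: equivariant_def gpres_def)
  note H = H0map_hcls[OF assms eq] and D = Dmap_dcls[OF assms eq] and K = equivariant_kerN[OF assms eq]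
  have 1: "H0map (TG U) (Tt U) f ` TD T \<subseteq> TD U \<longleftrightarrow> f ` tilde p T \<subseteq> tilde p U"
  proof -
    have "H0map (TG U) (Tt U) f ` TD T = (\<lambda>x. hcls (TG U) (Tt U) (f x)) ` tilde p T"
      unfolding T.TD_eq[symmetric] image_image using H T.W_closed by (intro image_cong) auto
    then have "H0map (TG U) (Tt U) f ` TD T \<subseteq> TD U \<longleftrightarrow> (\<forall>x\<in>tilde p T. hcls (TG U) (Tt U) (f x) \<in> TD U)"
      by auto
    also have "\<dots> \<longleftrightarrow> (\<forall>x\<in>tilde p T. f x \<in> tilde p U)"
      unfolding U.tilde_eq using K T.W_subset_kerN by (intro ball_cong) auto
    finally show ?thesis by auto
  qed
  have 2: "(\<forall>C\<in>TD T. Tal U (H0map (TG U) (Tt U) f C) = Dmap p U f (Tal T C)) \<longleftrightarrow>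
     (\<forall>x y. rel_al p T x y \<longrightarrow> rel_al p U (f x) (f y))" if sub: "f ` tilde p T \<subseteq> tilde p U"
  proof
    assume L: "\<forall>C\<in>TD T. Tal U (H0map (TG U) (Tt U) f C) = Dmap p U f (Tal T C)"
    show "\<forall>x y. rel_al p T x y \<longrightarrow> rel_al p U (f x) (f y)"
    proof (intro allI impI)
      fix x y assume "rel_al p T x y"
      then have xy: "x \<in> tilde p T" "y \<in> kerN p (TG T) (Tt T)"
        "Tal T (hcls (TG T) (Tt T) x) = dcls p (TG T) (Tt T) (TD T) y" by (auto simp: rel_al_def)
      have "hcls (TG T) (Tt T) x \<in> TD T" using xy by (auto simp: tilde_def)
      then have "Tal U (hcls (TG U) (Tt U) (f x)) = dcls p (TG U) (Tt U) (TD U) (f y)"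
        using L[rule_format, of "hcls (TG T) (Tt T) x"] D[OF sub xy(2)] xy(3) H[OF T.W_closed[OF xy(1)]]
        by simp
      then show "rel_al p U (f x) (f y)" using xy sub K by (auto simp: rel_al_def)
    qed
  next
    assume R: "\<forall>x y. rel_al p T x y \<longrightarrow> rel_al p U (f x) (f y)"
    show "\<forall>C\<in>TD T. Tal U (H0map (TG U) (Tt U) f C) = Dmap p U f (Tal T C)"
    proof
      fix C assume "C \<in> TD T"
      then obtain x where x: "x \<in> tilde p T" "C = hcls (TG T) (Tt T) x" unfolding T.TD_eq[symmetric] by auto
      \<comment> \<open>\<open>Tal\<close> takes values in the quotient of H_0, so each value is the
        class of some y; this makes the preservation of \<open>rel_al\<close> strong enough to
        recover the equation for every C.\<close>
      obtain y where y: "y \<in> kerN p (TG T) (Tt T)" "Tal T C = dcls p (TG T) (Tt T) (TD T) y"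
        using T.Tal_dcls[OF x(1)] x(2) by auto
      have "rel_al p U (f x) (f y)" using R x y by (auto simp: rel_al_def)
      then show "Tal U (H0map (TG U) (Tt U) f C) = Dmap p U f (Tal T C)"
        using x y H T.W_closed D[OF sub y(1)] by (simp add: rel_al_def)
    qed
  qed
  show ?thesis using True 1 2 by (auto simp: thoms_def)
qed

section \<open>From exact modules to triples\<close>

lemma Phi_simps [simp]:
  "TG (Phi p M) = KG0 M" "Tgr (Phi p M) = Kgr0 M" "Tt (Phi p M) = kt0 M" "TD (Phi p M) = PhiD M"
  by (simp_all add: Phi_def)

lemma hpart_H0gr: "hpart i (H0gr p G gr t) = hcls G t ` (hpart i gr \<inter> kerN p G t)"
  unfolding H0gr_def hpart_qgr hpart_Int ..

locale exact_kmod =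
  fixes p :: nat and M :: "('a, 'b, 'c) kmod"
  assumes kexact0: "kexact0 p M"
begin

lemma kmodule: "kmodule p M" and kexact: "kexact M"
  and a21: "y \<in> carrier (KG1 M) \<Longrightarrow> a21 M y = \<one>\<^bsub>KG2 M\<^esub>"
  using kexact0 by (simp_all add: kexact0_def)

lemma graded0: "graded (KG0 M) (Kgr0 M)" and graded1: "graded (KG1 M) (Kgr1 M)"
  and graded2: "graded (KG2 M) (Kgr2 M)"
  and gpres_a10: "gpres (a10 M) (KG0 M) (Kgr0 M) (KG1 M) (Kgr1 M)"
  and gpres_a01: "gpres (a01 M) (KG1 M) (Kgr1 M) (KG0 M) (Kgr0 M)"
  and gpres_a02: "gpres (a02 M) (KG2 M) (Kgr2 M) (KG0 M) (Kgr0 M)"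
  and gpres_a20: "gpres (a20 M) (KG0 M) (Kgr0 M) (KG2 M) (Kgr2 M)"
  and grev_a12: "grev (a12 M) (KG2 M) (Kgr2 M) (KG1 M) (Kgr1 M)"
  using kmodule by (simp_all add: kmodule_def)

lemma a01_a12: "x \<in> carrier (KG2 M) \<Longrightarrow> a01 M (a12 M x) = \<one>\<^bsub>KG0 M\<^esub>"
  and a10_a02: "x \<in> carrier (KG2 M) \<Longrightarrow> a10 M (a02 M x) = \<one>\<^bsub>KG1 M\<^esub>"
  and a01_a10: "z \<in> carrier (KG0 M) \<Longrightarrow> a01 M (a10 M z) = Nop p (KG0 M) (kt0 M) z"
  using kmodule by (simp_all add: kmodule_def kt0_def)

sublocale M0: plain_comm_group "KG0 M"
  by (rule plain_comm_groupI) (rule gradedD(1)[OF graded0])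

sublocale M1: plain_comm_group "KG1 M"
  by (rule plain_comm_groupI) (rule gradedD(1)[OF graded1])

sublocale M2: plain_comm_group "KG2 M"
  by (rule plain_comm_groupI) (rule gradedD(1)[OF graded2])

sublocale a10: group_hom "KG0 M" "KG1 M" "a10 M"
  using gpres_a10 by unfold_locales (simp add: gpres_def)

sublocale a01: group_hom "KG1 M" "KG0 M" "a01 M"
  using gpres_a01 by unfold_locales (simp add: gpres_def)

sublocale a02: group_hom "KG2 M" "KG0 M" "a02 M"
  using gpres_a02 by unfold_locales (simp add: gpres_def)

sublocale a20: group_hom "KG0 M" "KG2 M" "a20 M"
  using gpres_a20 by unfold_locales (simp add: gpres_def)

sublocale a12: group_hom "KG2 M" "KG1 M" "a12 M"
  using grev_a12 by unfold_locales (simp add: grev_def)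

lemma a10_surj: "a10 M ` carrier (KG0 M) = carrier (KG1 M)"
  and image_a02: "a02 M ` carrier (KG2 M) = {x \<in> carrier (KG0 M). a10 M x = \<one>\<^bsub>KG1 M\<^esub>}"
  and image_a20: "a20 M ` carrier (KG0 M) = {z \<in> carrier (KG2 M). a12 M z = \<one>\<^bsub>KG1 M\<^esub>}"
  and image_a12: "a12 M ` carrier (KG2 M) = {y \<in> carrier (KG1 M). a01 M y = \<one>\<^bsub>KG0 M\<^esub>}"
  and image_a01: "a01 M ` carrier (KG1 M) = {x \<in> carrier (KG0 M). a20 M x = \<one>\<^bsub>KG2 M\<^esub>}"
  using kexact a21 by (auto simp: kexact_def)

lemma a02_inj: "inj_on (a02 M) (carrier (KG2 M))"
unfolding a02.inj_on_one_iff
proof (intro allI impI)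
  fix x assume "x \<in> carrier (KG2 M)" "a02 M x = \<one>\<^bsub>KG0 M\<^esub>"
  then have "x \<in> a21 M ` carrier (KG1 M)" using kexact by (simp add: kexact_def)
  then show "x = \<one>\<^bsub>KG2 M\<^esub>" using a21 by auto
qed

section \<open>The action of t on M_0 of an exact module\<close>

sublocale om0: endo "KG0 M" "a02 M \<circ> a20 M"
  by unfold_locales (auto intro!: homI)

sublocale M0: endo "KG0 M" "kt0 M"
  unfolding kt0_def by unfold_locales (rule om0.om_hom)

lemma om_kt0: "x \<in> carrier (KG0 M) \<Longrightarrow> om (KG0 M) (kt0 M) x = a02 M (a20 M x)"
  by (simp add: om_def kt0_def M0.inv_mult M0.m_assoc[symmetric])

text \<open>1 - t^p = N(t)(1 - t) = a01 a10 a02 a20, which vanishes since a10 a02 = 0.\<close>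

lemma kt0_funpow:
  assumes "x \<in> carrier (KG0 M)" shows "(kt0 M ^^ p) x = x"
proof -
  have "x \<otimes>\<^bsub>KG0 M\<^esub> inv\<^bsub>KG0 M\<^esub> ((kt0 M ^^ p) x) = Nop p (KG0 M) (kt0 M) (om (KG0 M) (kt0 M) x)"
    using assms by (simp add: M0.Nop_om)
  also have "\<dots> = \<one>\<^bsub>KG0 M\<^esub>"
    using assms by (simp add: om_kt0 a01_a10[symmetric] a10_a02)
  finally show ?thesis
    using assms M0.inv_equality[of x "inv\<^bsub>KG0 M\<^esub> ((kt0 M ^^ p) x)"] M0.funpow_closed[OF assms, of p] by simp
qed

sublocale M0: cyclic_action "KG0 M" "kt0 M" p
  by unfold_locales (rule kt0_funpow)

lemma imom_kt0: "imom (KG0 M) (kt0 M) = a02 M ` a20 M ` carrier (KG0 M)"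
  unfolding imom_def image_image by (rule image_cong) (auto simp: om_kt0)

text \<open>The image of 1 - t = a02 a20 lies in that of \<open>a02\<close>, and N(t) a02 = a01 a10
  a02 = 0.\<close>

sublocale M0: cyclic_pair "KG0 M" "kt0 M" p "a02 M ` carrier (KG2 M)"
proof unfold_locales
  show "imom (KG0 M) (kt0 M) \<subseteq> a02 M ` carrier (KG2 M)"
    unfolding imom_kt0 by (intro image_mono) auto
  show "a02 M ` carrier (KG2 M) \<subseteq> kerN p (KG0 M) (kt0 M)"
    by (auto simp: kerN_def a01_a10[symmetric] a10_a02)
qed (use a02.img_is_subgroup in \<open>auto simp: subgroup_def\<close>)

lemma PhiD_eq: "PhiD M = hcls (KG0 M) (kt0 M) ` a02 M ` carrier (KG2 M)"
  by (simp add: PhiD_def)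

lemma tilde_Phi: "tilde p (Phi p M) = a02 M ` carrier (KG2 M)"
  unfolding tilde_def Phi_simps PhiD_eq by (rule M0.preimage_D)

section \<open>The connecting isomorphism: lifting \<open>a12\<close> along
  \<open>a10\<close>\<close>

lemma connecting_kerN:
  assumes "x \<in> carrier (KG2 M)" "y \<in> carrier (KG0 M)" "a10 M y = a12 M x"
  shows "y \<in> kerN p (KG0 M) (kt0 M)"
  using assms by (simp add: kerN_def a01_a10[symmetric] a01_a12)

lemma connecting_exists:
  assumes "x \<in> carrier (KG2 M)"
  obtains y where "y \<in> carrier (KG0 M)" "a10 M y = a12 M x"
  using assms a12.hom_closed[OF assms] unfolding a10_surj[symmetric] by auto

lemma kernel_a10_diff:
  assumes "y \<in> carrier (KG0 M)" "z \<in> carrier (KG0 M)"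
  shows "y \<otimes>\<^bsub>KG0 M\<^esub> inv\<^bsub>KG0 M\<^esub> z \<in> a02 M ` carrier (KG2 M) \<longleftrightarrow> a10 M y = a10 M z"
proof -
  have "y \<otimes>\<^bsub>KG0 M\<^esub> inv\<^bsub>KG0 M\<^esub> z \<in> a02 M ` carrier (KG2 M) \<longleftrightarrow>
      a10 M y \<otimes>\<^bsub>KG1 M\<^esub> inv\<^bsub>KG1 M\<^esub> (a10 M z) = \<one>\<^bsub>KG1 M\<^esub>"
    unfolding image_a02 using assms by simp
  also have "\<dots> \<longleftrightarrow> a10 M y = a10 M z"
    using assms M1.inv_equality[of "a10 M y" "inv\<^bsub>KG1 M\<^esub> (a10 M z)"] by auto
  finally show ?thesis .
qed

text \<open>Since ker a10 is the image of \<open>a02\<close>, the map \<open>a10\<close> embeds the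
  quotient of H_0 by the subspace into M_1.\<close>

lemma dcls_Phi_eq_iff:
  assumes "y \<in> kerN p (KG0 M) (kt0 M)" "z \<in> kerN p (KG0 M) (kt0 M)"
  shows "dcls p (KG0 M) (kt0 M) (PhiD M) y = dcls p (KG0 M) (kt0 M) (PhiD M) z \<longleftrightarrow> a10 M y = a10 M z"
  unfolding PhiD_eq using assms by (simp only: M0.dcls_eq_iff kernel_a10_diff M0.kerN_closed)

text \<open>As im(1-t) = a02(a20(M_0)) and \<open>a02\<close> is injective, the classes agree
  exactly if x - y lies in im a20 = ker a12. One direction makes the connecting map well defined,
  the other makes it injective.\<close>

lemma hcls_a02_eq_iff:
  assumes "x \<in> carrier (KG2 M)" "y \<in> carrier (KG2 M)"
  shows "hcls (KG0 M) (kt0 M) (a02 M x) = hcls (KG0 M) (kt0 M) (a02 M y) \<longleftrightarrow> a12 M x = a12 M y"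
proof -
  have "a02 M x \<otimes>\<^bsub>KG0 M\<^esub> inv\<^bsub>KG0 M\<^esub> (a02 M y) = a02 M (x \<otimes>\<^bsub>KG2 M\<^esub> inv\<^bsub>KG2 M\<^esub> y)"
    using assms by simp
  then have "hcls (KG0 M) (kt0 M) (a02 M x) = hcls (KG0 M) (kt0 M) (a02 M y) \<longleftrightarrow>
      a02 M (x \<otimes>\<^bsub>KG2 M\<^esub> inv\<^bsub>KG2 M\<^esub> y) \<in> a02 M ` a20 M ` carrier (KG0 M)"
    using assms by (subst M0.hcls_eq_iff) (simp_all add: imom_kt0)
  also have "\<dots> \<longleftrightarrow> x \<otimes>\<^bsub>KG2 M\<^esub> inv\<^bsub>KG2 M\<^esub> y \<in> a20 M ` carrier (KG0 M)"
    using assms by (intro inj_on_image_mem_iff[OF a02_inj]) auto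
  also have "\<dots> \<longleftrightarrow> a12 M x \<otimes>\<^bsub>KG1 M\<^esub> inv\<^bsub>KG1 M\<^esub> (a12 M y) = \<one>\<^bsub>KG1 M\<^esub>"
    unfolding image_a20 using assms by simp
  also have "\<dots> \<longleftrightarrow> a12 M x = a12 M y"
    using assms M1.inv_equality[of "a12 M x" "inv\<^bsub>KG1 M\<^esub> (a12 M y)"] by auto
  finally show ?thesis .
qed

text \<open>The choice in \<open>Phi\<close> is harmless: representatives x and x' of the same class
  have the same image under \<open>a12\<close>, so all their lifts along \<open>a10\<close> differ
  by elements of im a02.\<close>

lemma Tal_Phi:
  assumes "x \<in> carrier (KG2 M)" "y \<in> carrier (KG0 M)" "a10 M y = a12 M x"
  shows "Tal (Phi p M) (hcls (KG0 M) (kt0 M) (a02 M x)) = dcls p (KG0 M) (kt0 M) (PhiD M) y"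
proof -
  have "(SOME Z. \<exists>x'\<in>carrier (KG2 M). \<exists>y'\<in>kerN p (KG0 M) (kt0 M).
      hcls (KG0 M) (kt0 M) (a02 M x) = hcls (KG0 M) (kt0 M) (a02 M x') \<and> a10 M y' = a12 M x' \<and>
      Z = dcls p (KG0 M) (kt0 M) (PhiD M) y') = dcls p (KG0 M) (kt0 M) (PhiD M) y"
  proof (intro some_equality bexI conjI)
    fix Z assume "\<exists>x'\<in>carrier (KG2 M). \<exists>y'\<in>kerN p (KG0 M) (kt0 M).
      hcls (KG0 M) (kt0 M) (a02 M x) = hcls (KG0 M) (kt0 M) (a02 M x') \<and> a10 M y' = a12 M x' \<and>
      Z = dcls p (KG0 M) (kt0 M) (PhiD M) y'"
    then obtain x' y' where x': "x' \<in> carrier (KG2 M)"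
      "hcls (KG0 M) (kt0 M) (a02 M x) = hcls (KG0 M) (kt0 M) (a02 M x')"
      and y': "y' \<in> kerN p (KG0 M) (kt0 M)" "a10 M y' = a12 M x'"
      and Z: "Z = dcls p (KG0 M) (kt0 M) (PhiD M) y'" by blast
    have "a10 M y' = a10 M y" using x' y' assms by (simp add: hcls_a02_eq_iff[OF assms(1) x'(1)])
    then show "Z = dcls p (KG0 M) (kt0 M) (PhiD M) y"
      unfolding Z using dcls_Phi_eq_iff[OF y'(1) connecting_kerN[OF assms]] by simp
  qed (use assms connecting_kerN[OF assms] in auto)
  then show ?thesis by (simp add: Phi_def)
qed

lemma pretriple_Phi: "pretriple p (Phi p M)"
proof -
  have "Tal (Phi p M) C \<in> carrier (H0 p (KG0 M) (kt0 M) Mod PhiD M)" if "C \<in> PhiD M" for C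
  proof -
    obtain x where x: "x \<in> carrier (KG2 M)" "C = hcls (KG0 M) (kt0 M) (a02 M x)"
      using \<open>C \<in> PhiD M\<close> by (auto simp: PhiD_eq)
    obtain y where y: "y \<in> carrier (KG0 M)" "a10 M y = a12 M x" using connecting_exists[OF x(1)] .
    show ?thesis
      unfolding x(2) Tal_Phi[OF x(1) y] using M0.carrier_H0_Mod connecting_kerN[OF x(1) y]
      unfolding PhiD_eq by blast
  qed
  then show ?thesis
    using M0.D_subgroup M0.cyclic_action_axioms
    by (intro pretriple.intro pretriple_axioms.intro) (simp_all add: PhiD_eq)
qed

sublocale Phi: pretriple p "Phi p M"
  by (rule pretriple_Phi)

text \<open>Lifts of one element of M_1 represent one class, so membership in the relation is just a
  condition on the structure maps of M.\<close>

lemma rel_al_Phi: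
  "rel_al p (Phi p M) u v \<longleftrightarrow>
    v \<in> carrier (KG0 M) \<and> (\<exists>x\<in>carrier (KG2 M). u = a02 M x \<and> a10 M v = a12 M x)"
proof
  assume r: "rel_al p (Phi p M) u v"
  then obtain x where x: "x \<in> carrier (KG2 M)" "u = a02 M x"
    by (auto simp: rel_al_def tilde_Phi)
  have v: "v \<in> kerN p (KG0 M) (kt0 M)" using r by (simp add: rel_al_def)
  obtain y where y: "y \<in> carrier (KG0 M)" "a10 M y = a12 M x" using connecting_exists[OF x(1)] .
  have "dcls p (KG0 M) (kt0 M) (PhiD M) v = dcls p (KG0 M) (kt0 M) (PhiD M) y"
    using r x Tal_Phi[OF x(1) y] by (simp add: rel_al_def)
  then have "a10 M v = a10 M y" using dcls_Phi_eq_iff[OF v connecting_kerN[OF x(1) y]] by simp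
  then show "v \<in> carrier (KG0 M) \<and> (\<exists>x\<in>carrier (KG2 M). u = a02 M x \<and> a10 M v = a12 M x)"
    using x y v M0.kerN_closed by auto
next
  assume "v \<in> carrier (KG0 M) \<and> (\<exists>x\<in>carrier (KG2 M). u = a02 M x \<and> a10 M v = a12 M x)"
  then show "rel_al p (Phi p M) u v"
    using Tal_Phi connecting_kerN by (auto simp: rel_al_def tilde_Phi)
qed

lemma Tal_Phi_iso:
  "Tal (Phi p M) \<in> iso (H0 p (KG0 M) (kt0 M)\<lparr>carrier := PhiD M\<rparr>) (H0 p (KG0 M) (kt0 M) Mod PhiD M)"
proof (rule isoI)
  show "Tal (Phi p M) \<in> hom (H0 p (KG0 M) (kt0 M)\<lparr>carrier := PhiD M\<rparr>) (H0 p (KG0 M) (kt0 M) Mod PhiD M)"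
  proof (rule homI)
    fix C assume "C \<in> carrier (H0 p (KG0 M) (kt0 M)\<lparr>carrier := PhiD M\<rparr>)"
    then show "Tal (Phi p M) C \<in> carrier (H0 p (KG0 M) (kt0 M) Mod PhiD M)"
      using Phi.Tal_carrier by simp
  next
    fix C D assume "C \<in> carrier (H0 p (KG0 M) (kt0 M)\<lparr>carrier := PhiD M\<rparr>)"
      "D \<in> carrier (H0 p (KG0 M) (kt0 M)\<lparr>carrier := PhiD M\<rparr>)"
    then obtain c d where cd: "c \<in> carrier (KG2 M)" "C = hcls (KG0 M) (kt0 M) (a02 M c)"
      "d \<in> carrier (KG2 M)" "D = hcls (KG0 M) (kt0 M) (a02 M d)"
      by (auto simp: PhiD_eq)
    obtain y where y: "y \<in> carrier (KG0 M)" "a10 M y = a12 M c" using connecting_exists[OF cd(1)] .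
    obtain z where z: "z \<in> carrier (KG0 M)" "a10 M z = a12 M d" using connecting_exists[OF cd(3)] .
    note yk = connecting_kerN[OF cd(1) y] and zk = connecting_kerN[OF cd(3) z]
    have "C \<otimes>\<^bsub>H0 p (KG0 M) (kt0 M)\<^esub> D = hcls (KG0 M) (kt0 M) (a02 M c \<otimes>\<^bsub>KG0 M\<^esub> a02 M d)"
      unfolding cd using cd(1,3) M0.W_subset_kerN by (intro M0.hcls_mult) auto
    also have "\<dots> = hcls (KG0 M) (kt0 M) (a02 M (c \<otimes>\<^bsub>KG2 M\<^esub> d))" using cd by simp
    finally have "Tal (Phi p M) (C \<otimes>\<^bsub>H0 p (KG0 M) (kt0 M)\<^esub> D) =
        dcls p (KG0 M) (kt0 M) (PhiD M) (y \<otimes>\<^bsub>KG0 M\<^esub> z)"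
      using cd y z Tal_Phi[of "c \<otimes>\<^bsub>KG2 M\<^esub> d" "y \<otimes>\<^bsub>KG0 M\<^esub> z"] by simp
    also have "\<dots> = dcls p (KG0 M) (kt0 M) (PhiD M) y \<otimes>\<^bsub>H0 p (KG0 M) (kt0 M) Mod PhiD M\<^esub>
        dcls p (KG0 M) (kt0 M) (PhiD M) z"
      using M0.dcls_mult[OF yk zk] unfolding PhiD_eq by simp
    finally show "Tal (Phi p M) (C \<otimes>\<^bsub>H0 p (KG0 M) (kt0 M)\<lparr>carrier := PhiD M\<rparr>\<^esub> D) =
        Tal (Phi p M) C \<otimes>\<^bsub>H0 p (KG0 M) (kt0 M) Mod PhiD M\<^esub> Tal (Phi p M) D"
      unfolding cd Tal_Phi[OF cd(1) y] Tal_Phi[OF cd(3) z] by simp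
  qed
  show "bij_betw (Tal (Phi p M)) (carrier (H0 p (KG0 M) (kt0 M)\<lparr>carrier := PhiD M\<rparr>))
      (carrier (H0 p (KG0 M) (kt0 M) Mod PhiD M))"
  proof (rule bij_betwI')
    fix C D assume "C \<in> carrier (H0 p (KG0 M) (kt0 M)\<lparr>carrier := PhiD M\<rparr>)"
      "D \<in> carrier (H0 p (KG0 M) (kt0 M)\<lparr>carrier := PhiD M\<rparr>)"
    then obtain c d where cd: "c \<in> carrier (KG2 M)" "C = hcls (KG0 M) (kt0 M) (a02 M c)"
      "d \<in> carrier (KG2 M)" "D = hcls (KG0 M) (kt0 M) (a02 M d)"
      by (auto simp: PhiD_eq)
    obtain y where y: "y \<in> carrier (KG0 M)" "a10 M y = a12 M c" using connecting_exists[OF cd(1)] .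
    obtain z where z: "z \<in> carrier (KG0 M)" "a10 M z = a12 M d" using connecting_exists[OF cd(3)] .
    show "(Tal (Phi p M) C = Tal (Phi p M) D) = (C = D)"
      unfolding cd Tal_Phi[OF cd(1) y] Tal_Phi[OF cd(3) z] hcls_a02_eq_iff[OF cd(1,3)]
        dcls_Phi_eq_iff[OF connecting_kerN[OF cd(1) y] connecting_kerN[OF cd(3) z]] y z ..
  next
    fix C assume "C \<in> carrier (H0 p (KG0 M) (kt0 M)\<lparr>carrier := PhiD M\<rparr>)"
    then show "Tal (Phi p M) C \<in> carrier (H0 p (KG0 M) (kt0 M) Mod PhiD M)"
      using Phi.Tal_carrier by simp
  next
    fix Z assume "Z \<in> carrier (H0 p (KG0 M) (kt0 M) Mod PhiD M)"
    then obtain y where y: "y \<in> kerN p (KG0 M) (kt0 M)" "Z = dcls p (KG0 M) (kt0 M) (PhiD M) y"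
      using M0.carrier_H0_Mod unfolding PhiD_eq by auto
    have yc: "y \<in> carrier (KG0 M)" using y M0.kerN_closed by simp
    \<comment> \<open>N(t) y = a01(a10 y) vanishes, so exactness at M_1 supplies the preimage under
      \<open>a12\<close>.\<close>
    then have "a10 M y \<in> a12 M ` carrier (KG2 M)"
      unfolding image_a12 using y by (simp add: a01_a10 kerN_def)
    then obtain c where c: "c \<in> carrier (KG2 M)" "a10 M y = a12 M c" by auto
    then show "\<exists>C\<in>carrier (H0 p (KG0 M) (kt0 M)\<lparr>carrier := PhiD M\<rparr>). Z = Tal (Phi p M) C"
      using Tal_Phi[OF c(1) yc c(2)] y by (intro bexI[of _ "hcls (KG0 M) (kt0 M) (a02 M c)"]) (auto simp: PhiD_eq)
  qed
qed

lemma a02_homogeneous: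
  assumes "x \<in> carrier (KG2 M)" "a02 M x \<in> hpart i (Kgr0 M)"
  shows "x \<in> hpart i (Kgr2 M)"
proof -
  obtain c where c: "c \<in> hpart i (Kgr2 M)" "a02 M c = a02 M x"
    using homogeneous_preimage[OF graded2 graded0 gpres_a02 assms] .
  then have "c = x" using inj_onD[OF a02_inj] assms(1) gradedD(3)[OF graded2] by blast
  then show ?thesis using c by simp
qed

lemma PhiD_graded:
  assumes "C \<in> PhiD M"
  shows "\<exists>a\<in>PhiD M \<inter> hpart False (H0gr p (KG0 M) (Kgr0 M) (kt0 M)).
    \<exists>b\<in>PhiD M \<inter> hpart True (H0gr p (KG0 M) (Kgr0 M) (kt0 M)). C = a \<otimes>\<^bsub>H0 p (KG0 M) (kt0 M)\<^esub> b"
proof -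
  obtain x where x: "x \<in> carrier (KG2 M)" "C = hcls (KG0 M) (kt0 M) (a02 M x)"
    using assms by (auto simp: PhiD_eq)
  obtain c d where cd: "c \<in> hpart False (Kgr2 M)" "d \<in> hpart (\<not> False) (Kgr2 M)" "x = c \<otimes>\<^bsub>KG2 M\<^esub> d"
    using graded_split[OF graded2 x(1)] .
  have cdc: "c \<in> carrier (KG2 M)" "d \<in> carrier (KG2 M)" using cd gradedD(3)[OF graded2] by blast+
  have part: "hcls (KG0 M) (kt0 M) (a02 M e) \<in> PhiD M \<inter> hpart i (H0gr p (KG0 M) (Kgr0 M) (kt0 M))"
    if "e \<in> carrier (KG2 M)" "e \<in> hpart i (Kgr2 M)" for e i
    unfolding hpart_H0gr PhiD_eq
    using that gpres_hpart[OF gpres_a02 that(2)] M0.W_subset_kerN by (intro IntI imageI) auto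
  have "C = hcls (KG0 M) (kt0 M) (a02 M c) \<otimes>\<^bsub>H0 p (KG0 M) (kt0 M)\<^esub> hcls (KG0 M) (kt0 M) (a02 M d)"
    using x cd cdc M0.W_subset_kerN by (subst M0.hcls_mult) auto
  moreover have "hcls (KG0 M) (kt0 M) (a02 M d) \<in> PhiD M \<inter> hpart True (H0gr p (KG0 M) (Kgr0 M) (kt0 M))"
    using part[OF cdc(2), of True] cd by simp
  ultimately show ?thesis using part[OF cdc(1) cd(1)] by blast
qed

lemma Tal_Phi_grev:
  "Tal (Phi p M) ` (PhiD M \<inter> hpart i (H0gr p (KG0 M) (Kgr0 M) (kt0 M))) \<subseteq>
    hpart (\<not> i) (qgr (H0 p (KG0 M) (kt0 M)) (PhiD M) (H0gr p (KG0 M) (Kgr0 M) (kt0 M)))"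
proof
  fix Z assume "Z \<in> Tal (Phi p M) ` (PhiD M \<inter> hpart i (H0gr p (KG0 M) (Kgr0 M) (kt0 M)))"
  then obtain a where a: "a \<in> hpart i (Kgr0 M)" "a \<in> kerN p (KG0 M) (kt0 M)"
    "hcls (KG0 M) (kt0 M) a \<in> PhiD M" "Z = Tal (Phi p M) (hcls (KG0 M) (kt0 M) a)"
    unfolding hpart_H0gr by auto
  then have "a \<in> a02 M ` carrier (KG2 M)"
    using M0.hcls_mem_D_iff M0.kerN_closed unfolding PhiD_eq by simp
  then obtain x where x: "x \<in> carrier (KG2 M)" "a = a02 M x" by auto
  have "x \<in> hpart i (Kgr2 M)" using a02_homogeneous[OF x(1)] a x by simp
  then have ax: "a12 M x \<in> hpart (\<not> i) (Kgr1 M)" by (rule grev_hpart[OF grev_a12])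
  obtain y where y: "y \<in> carrier (KG0 M)" "a10 M y = a12 M x" using connecting_exists[OF x(1)] .
  \<comment> \<open>The lift y need not be homogeneous, but \<open>a12\<close> has reversed the
    degree of x and \<open>a10\<close> preserves degrees, so y may be replaced by its component in
    the degree of a12 x.\<close>
  obtain b where b: "b \<in> hpart (\<not> i) (Kgr0 M)" "a10 M b = a10 M y"
    using homogeneous_preimage[OF graded0 graded1 gpres_a10 y(1)] ax y by metis
  have bx: "b \<in> carrier (KG0 M)" "a10 M b = a12 M x" using b y gradedD(3)[OF graded0] by auto
  have "Z = dcls p (KG0 M) (kt0 M) (PhiD M) b" using Tal_Phi[OF x(1) bx] a x by simp
  then show "Z \<in> hpart (\<not> i) (qgr (H0 p (KG0 M) (kt0 M)) (PhiD M) (H0gr p (KG0 M) (Kgr0 M) (kt0 M)))"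
    unfolding hpart_qgr hpart_H0gr using b connecting_kerN[OF x(1) bx] by blast
qed

lemma gpres_kt0: "gpres (kt0 M) (KG0 M) (Kgr0 M) (KG0 M) (Kgr0 M)"
  unfolding gpres_iff
proof (intro conjI allI M0.t_hom image_subsetI)
  fix i x assume x: "x \<in> hpart i (Kgr0 M)"
  interpret S: subgroup "hpart i (Kgr0 M)" "KG0 M" by (rule gradedD(2)[OF graded0])
  have "a02 M (a20 M x) \<in> hpart i (Kgr0 M)"
    using x by (intro gpres_hpart[OF gpres_a02] gpres_hpart[OF gpres_a20])
  then show "kt0 M x \<in> hpart i (Kgr0 M)" using x by (simp add: kt0_def om_def)
qed

text \<open>Since \<open>a02\<close> is injective, ker(1-t) = ker a20; this is im a01 by exactness,
  and im(a01 a10) = im N(t) because \<open>a10\<close> is surjective.\<close>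

lemma kernel_om_kt0:
  "{x \<in> carrier (KG0 M). om (KG0 M) (kt0 M) x = \<one>\<^bsub>KG0 M\<^esub>} = Nop p (KG0 M) (kt0 M) ` carrier (KG0 M)"
proof -
  have "{x \<in> carrier (KG0 M). om (KG0 M) (kt0 M) x = \<one>\<^bsub>KG0 M\<^esub>} =
      {x \<in> carrier (KG0 M). a20 M x = \<one>\<^bsub>KG2 M\<^esub>}"
    using a02_inj unfolding a02.inj_on_one_iff by (auto simp: om_kt0)
  also have "\<dots> = a01 M ` a10 M ` carrier (KG0 M)" by (simp add: image_a01 a10_surj)
  also have "\<dots> = Nop p (KG0 M) (kt0 M) ` carrier (KG0 M)"
    unfolding image_image by (intro image_cong) (simp_all add: a01_a10)
  finally show ?thesis .
qed

lemma valid_triple_Phi: "valid_triple p (Phi p M)"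
  unfolding valid_triple_def Phi_simps
proof (intro conjI ballI)
  show "Tal (Phi p M) ` (PhiD M \<inter> fst (H0gr p (KG0 M) (Kgr0 M) (kt0 M))) \<subseteq>
      snd (qgr (H0 p (KG0 M) (kt0 M)) (PhiD M) (H0gr p (KG0 M) (Kgr0 M) (kt0 M)))"
    using Tal_Phi_grev[of False] by simp
  show "Tal (Phi p M) ` (PhiD M \<inter> snd (H0gr p (KG0 M) (Kgr0 M) (kt0 M))) \<subseteq>
      fst (qgr (H0 p (KG0 M) (kt0 M)) (PhiD M) (H0gr p (KG0 M) (Kgr0 M) (kt0 M)))"
    using Tal_Phi_grev[of True] by simp
qed (use graded0 gpres_kt0 kt0_funpow kernel_om_kt0 Phi.TD_subgroup PhiD_graded Tal_Phi_iso in auto)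

end

section \<open>Full faithfulness\<close>

lemma khoms_cancel:
  assumes M: "exact_kmod p M" and L: "exact_kmod p L" and f: "(f0, f1, f2) \<in> khoms M L"
  shows "\<And>x. x \<in> carrier (KG0 M) \<Longrightarrow> f1 (a10 M x) = a10 L (f0 x)"
    and "\<And>x. x \<in> carrier (KG2 M) \<Longrightarrow> f0 (a02 M x) = a02 L (f2 x)"
    and "group_hom (KG0 M) (KG0 L) f0" "group_hom (KG1 M) (KG1 L) f1" "group_hom (KG2 M) (KG2 L) f2"
proof -
  interpret M: exact_kmod p M by fact
  interpret L: exact_kmod p L by fact
  show "f1 (a10 M x) = a10 L (f0 x)" if "x \<in> carrier (KG0 M)" for x
    using f that by (simp add: khoms_def)
  show "f0 (a02 M x) = a02 L (f2 x)" if "x \<in> carrier (KG2 M)" for x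
    using f that by (simp add: khoms_def)
  show "group_hom (KG0 M) (KG0 L) f0" "group_hom (KG1 M) (KG1 L) f1" "group_hom (KG2 M) (KG2 L) f2"
    using f by (auto intro!: group_hom.intro group_hom_axioms.intro simp: khoms_def gpres_def M.M0.is_group
        M.M1.is_group M.M2.is_group L.M0.is_group L.M1.is_group L.M2.is_group)
qed

lemma khoms_fst_inj:
  assumes M: "exact_kmod p M" and L: "exact_kmod p L"
  shows "inj_on fst (khoms M L)"
proof (rule inj_onI)
  interpret M: exact_kmod p M by fact
  interpret L: exact_kmod p L by fact
  fix F G assume FG: "F \<in> khoms M L" "G \<in> khoms M L" "fst F = fst G"
  obtain f0 f1 f2 where F: "F = (f0, f1, f2)" by (cases F)
  obtain g1 g2 where G: "G = (f0, g1, g2)" using FG(3) F by (cases G) auto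
  note f = khoms_cancel[OF M L FG(1)[unfolded F]] and g = khoms_cancel[OF M L FG(2)[unfolded G]]
  interpret f2: group_hom "KG2 M" "KG2 L" f2 by (rule f(5))
  interpret g2: group_hom "KG2 M" "KG2 L" g2 by (rule g(5))
  have "f1 = g1"
  proof (rule extensionalityI)
    show "f1 \<in> extensional (carrier (KG1 M))" "g1 \<in> extensional (carrier (KG1 M))"
      using FG F G by (auto simp: khoms_def)
    show "f1 y = g1 y" if "y \<in> carrier (KG1 M)" for y
      using that f(1) g(1) by (auto simp: M.a10_surj[symmetric])
  qed
  moreover have "f2 = g2"
  proof (rule extensionalityI)
    show "f2 \<in> extensional (carrier (KG2 M))" "g2 \<in> extensional (carrier (KG2 M))"
      using FG F G by (auto simp: khoms_def)
    show "f2 x = g2 x" if x: "x \<in> carrier (KG2 M)" for x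
      by (rule inj_onD[OF L.a02_inj]) (use x f(2) g(2) in \<open>auto simp del: L.a02.hom_mult\<close>)
  qed
  ultimately show "F = G" using F G by simp
qed

lemma khoms_fst_thoms:
  assumes M: "exact_kmod p M" and L: "exact_kmod p L" and f: "(f0, f1, f2) \<in> khoms M L"
  shows "f0 \<in> thoms p (Phi p M) (Phi p L)"
proof -
  interpret M: exact_kmod p M by fact
  interpret L: exact_kmod p L by fact
  note c = khoms_cancel[OF M L f]
  interpret f0: group_hom "KG0 M" "KG0 L" f0 by (rule c(3))
  interpret f2: group_hom "KG2 M" "KG2 L" f2 by (rule c(5))
  have c2: "f2 (a20 M x) = a20 L (f0 x)" if "x \<in> carrier (KG0 M)" for x
    using f that by (simp add: khoms_def)
  have c12: "f1 (a12 M x) = a12 L (f2 x)" if "x \<in> carrier (KG2 M)" for x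
    using f that by (simp add: khoms_def)
  show ?thesis
    unfolding thoms_iff[OF M.pretriple_Phi L.pretriple_Phi] Phi_simps
  proof (intro conjI ballI allI impI)
    show "gpres f0 (KG0 M) (Kgr0 M) (KG0 L) (Kgr0 L)" "f0 \<in> extensional (carrier (KG0 M))"
      using f by (auto simp: khoms_def)
    show "f0 (kt0 M x) = kt0 L (f0 x)" if "x \<in> carrier (KG0 M)" for x
      using that by (simp add: kt0_def om_def c(2) c2)
    show "f0 ` tilde p (Phi p M) \<subseteq> tilde p (Phi p L)"
      unfolding M.tilde_Phi L.tilde_Phi by (auto simp: c(2))
    show "rel_al p (Phi p L) (f0 u) (f0 v)" if r: "rel_al p (Phi p M) u v" for u v
    proof -
      obtain x where x: "v \<in> carrier (KG0 M)" "x \<in> carrier (KG2 M)" "u = a02 M x" "a10 M v = a12 M x"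
        using r unfolding M.rel_al_Phi by auto
      have "a10 L (f0 v) = a12 L (f2 x)" using x c(1)[OF x(1)] c12 by simp
      then show ?thesis unfolding L.rel_al_Phi using x c(2) by auto
    qed
  qed
qed

lemma thoms_lift:
  assumes M: "exact_kmod p M" and L: "exact_kmod p L" and f: "f0 \<in> thoms p (Phi p M) (Phi p L)"
  shows "\<exists>f1 f2. (f0, f1, f2) \<in> khoms M L"
proof -
  interpret M: exact_kmod p M by fact
  interpret L: exact_kmod p L by fact
  have gp: "gpres f0 (KG0 M) (Kgr0 M) (KG0 L) (Kgr0 L)" and ext: "f0 \<in> extensional (carrier (KG0 M))"
    and ft: "\<And>x. x \<in> carrier (KG0 M) \<Longrightarrow> f0 (kt0 M x) = kt0 L (f0 x)"
    and ftilde: "f0 ` a02 M ` carrier (KG2 M) \<subseteq> a02 L ` carrier (KG2 L)"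
    and frel: "\<And>u v. rel_al p (Phi p M) u v \<Longrightarrow> rel_al p (Phi p L) (f0 u) (f0 v)"
    using f unfolding thoms_iff[OF M.pretriple_Phi L.pretriple_Phi] Phi_simps M.tilde_Phi L.tilde_Phi
    by auto
  interpret f0: group_hom "KG0 M" "KG0 L" f0
    using gp by unfold_locales (simp add: gpres_def)
  \<comment> \<open>Arbitrary preimages suffice: f0 sends ker a10 = im a02 of M into that of L, so
    the value of f1 is independent of the lift, and preimages under \<open>a02\<close> of L are
    unique.\<close>
  define f1 where "f1 = restrict (\<lambda>y. a10 L (f0 (inv_into (carrier (KG0 M)) (a10 M) y))) (carrier (KG1 M))"
  define f2 where "f2 = restrict (\<lambda>x. inv_into (carrier (KG2 L)) (a02 L) (f0 (a02 M x))) (carrier (KG2 M))"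
  have f1: "f1 (a10 M x) = a10 L (f0 x)" if x: "x \<in> carrier (KG0 M)" for x
  proof -
    define z where "z = inv_into (carrier (KG0 M)) (a10 M) (a10 M x)"
    have z: "z \<in> carrier (KG0 M)" "a10 M z = a10 M x"
      using x by (auto simp: z_def inv_into_into f_inv_into_f)
    then have "z \<otimes>\<^bsub>KG0 M\<^esub> inv\<^bsub>KG0 M\<^esub> x \<in> a02 M ` carrier (KG2 M)"
      using M.kernel_a10_diff[OF z(1) x] by simp
    then have "f0 (z \<otimes>\<^bsub>KG0 M\<^esub> inv\<^bsub>KG0 M\<^esub> x) \<in> a02 L ` carrier (KG2 L)"
      using ftilde by blast
    then have "a10 L (f0 z) = a10 L (f0 x)"
      using L.kernel_a10_diff[of "f0 z" "f0 x"] z x by simp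
    then show ?thesis using x by (simp add: f1_def z_def)
  qed
  have f2: "f2 x \<in> carrier (KG2 L)" "a02 L (f2 x) = f0 (a02 M x)" if x: "x \<in> carrier (KG2 M)" for x
  proof -
    have "f0 (a02 M x) \<in> a02 L ` carrier (KG2 L)" using ftilde x by blast
    then show "f2 x \<in> carrier (KG2 L)" "a02 L (f2 x) = f0 (a02 M x)"
      using x by (auto simp: f2_def inv_into_into f_inv_into_f)
  qed
  have a02_cancel: "x = y" if "a02 L x = a02 L y" "x \<in> carrier (KG2 L)" "y \<in> carrier (KG2 L)" for x y
    using inj_onD[OF L.a02_inj that] .
  have f1_closed: "f1 y \<in> carrier (KG1 L)" if "y \<in> carrier (KG1 M)" for y
    using that f1 by (auto simp: M.a10_surj[symmetric])
  have "gpres f1 (KG1 M) (Kgr1 M) (KG1 L) (Kgr1 L)"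
    unfolding gpres_iff
  proof (intro conjI allI image_subsetI homI f1_closed)
    fix x y assume "x \<in> carrier (KG1 M)" "y \<in> carrier (KG1 M)"
    then obtain u v where uv: "u \<in> carrier (KG0 M)" "v \<in> carrier (KG0 M)" "x = a10 M u" "y = a10 M v"
      by (auto simp: M.a10_surj[symmetric])
    then have "x \<otimes>\<^bsub>KG1 M\<^esub> y = a10 M (u \<otimes>\<^bsub>KG0 M\<^esub> v)" by simp
    then show "f1 (x \<otimes>\<^bsub>KG1 M\<^esub> y) = f1 x \<otimes>\<^bsub>KG1 L\<^esub> f1 y"
      using uv f1 by (simp del: M.a10.hom_mult)
  next
    fix i y assume y: "y \<in> hpart i (Kgr1 M)"
    then have "y \<in> carrier (KG1 M)" using gradedD(3)[OF M.graded1] by blast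
    then obtain u where u: "u \<in> carrier (KG0 M)" "y = a10 M u"
      by (auto simp: M.a10_surj[symmetric])
    \<comment> \<open>f1 preserves degrees because homogeneous elements of M_1 have homogeneous
      lifts to M_0.\<close>
    obtain v where v: "v \<in> hpart i (Kgr0 M)" "a10 M v = y"
      using homogeneous_preimage[OF M.graded0 M.graded1 M.gpres_a10 u(1)] u y by metis
    then have "f1 y = a10 L (f0 v)" using f1[of v] gradedD(3)[OF M.graded0] by blast
    then show "f1 y \<in> hpart i (Kgr1 L)"
      using gpres_hpart[OF L.gpres_a10 gpres_hpart[OF gp v(1)]] by simp
  qed simp
  moreover have "gpres f2 (KG2 M) (Kgr2 M) (KG2 L) (Kgr2 L)"
    unfolding gpres_iff
  proof (intro conjI allI image_subsetI homI f2(1))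
    fix x y assume "x \<in> carrier (KG2 M)" "y \<in> carrier (KG2 M)"
    then show "f2 (x \<otimes>\<^bsub>KG2 M\<^esub> y) = f2 x \<otimes>\<^bsub>KG2 L\<^esub> f2 y"
      using f2 by (intro a02_cancel) auto
  next
    fix i x assume x: "x \<in> hpart i (Kgr2 M)"
    then have xc: "x \<in> carrier (KG2 M)" using gradedD(3)[OF M.graded2] by blast
    have "a02 L (f2 x) \<in> hpart i (Kgr0 L)"
      using f2(2)[OF xc] gpres_hpart[OF gp gpres_hpart[OF M.gpres_a02 x]] by simp
    then show "f2 x \<in> hpart i (Kgr2 L)" using L.a02_homogeneous f2(1)[OF xc] by blast
  qed simp
  moreover have "f0 (a01 M y) = a01 L (f1 y)" if y: "y \<in> carrier (KG1 M)" for y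
  proof -
    obtain u where u: "u \<in> carrier (KG0 M)" "y = a10 M u"
      using y by (auto simp: M.a10_surj[symmetric])
    \<comment> \<open>On a lift u the square for \<open>a01\<close> becomes the naturality of N(t) =
      a01 a10.\<close>
    have "f0 (Nop p (KG0 M) (kt0 M) u) = Nop p (KG0 L) (kt0 L) (f0 u)"
      by (rule hom_Nop[OF M.M0.endo_axioms L.M0.endo_axioms f0.homh ft u(1)])
    then show ?thesis using u by (simp add: M.a01_a10 L.a01_a10 f1)
  qed
  moreover have "f2 (a20 M x) = a20 L (f0 x)" if x: "x \<in> carrier (KG0 M)" for x
  proof (rule a02_cancel)
    \<comment> \<open>After the injective \<open>a02\<close> the square for \<open>a20\<close>
      becomes compatibility of f0 with 1 - t.\<close>
    have "a02 L (f2 (a20 M x)) = f0 (om (KG0 M) (kt0 M) x)" using x by (simp add: f2 M.om_kt0)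
    also have "\<dots> = om (KG0 L) (kt0 L) (f0 x)" using x ft by (simp add: om_def)
    also have "\<dots> = a02 L (a20 L (f0 x))" using x by (simp add: L.om_kt0)
    finally show "a02 L (f2 (a20 M x)) = a02 L (a20 L (f0 x))" .
  qed (use x f2 in auto)
  moreover have "f1 (a12 M x) = a12 L (f2 x)" if x: "x \<in> carrier (KG2 M)" for x
  proof -
    obtain y where y: "y \<in> carrier (KG0 M)" "a10 M y = a12 M x" using M.connecting_exists[OF x] .
    \<comment> \<open>The square for \<open>a12\<close> is where the intertwining of the two
      isomorphisms enters.\<close>
    then have "rel_al p (Phi p L) (f0 (a02 M x)) (f0 y)" using x by (intro frel) (auto simp: M.rel_al_Phi)
    then obtain z where z: "z \<in> carrier (KG2 L)" "f0 (a02 M x) = a02 L z" "a10 L (f0 y) = a12 L z"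
      by (auto simp: L.rel_al_Phi)
    then have "f2 x = z" using f2[OF x] by (intro a02_cancel) auto
    then show ?thesis using z y f1[OF y(1)] by simp
  qed
  moreover have "f2 (a21 M y) = a21 L (f1 y)" if "y \<in> carrier (KG1 M)" for y
  proof -
    have "f2 \<one>\<^bsub>KG2 M\<^esub> = \<one>\<^bsub>KG2 L\<^esub>" using f2 by (intro a02_cancel) auto
    then show ?thesis using that f1_closed by (simp add: M.a21 L.a21)
  qed
  ultimately have "(f0, f1, f2) \<in> khoms M L"
    using gp ext f1 f2 by (simp add: khoms_def) (simp add: f1_def f2_def)
  then show ?thesis by blast
qed

lemma khoms_bij_thoms:
  assumes M: "exact_kmod p M" and L: "exact_kmod p L"
  shows "bij_betw fst (khoms M L) (thoms p (Phi p M) (Phi p L))"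
  unfolding bij_betw_def
proof (intro conjI khoms_fst_inj[OF M L] subset_antisym subsetI)
  fix f assume "f \<in> fst ` khoms M L"
  then show "f \<in> thoms p (Phi p M) (Phi p L)" using khoms_fst_thoms[OF M L] by auto
next
  fix f assume "f \<in> thoms p (Phi p M) (Phi p L)"
  then obtain f1 f2 where "(f, f1, f2) \<in> khoms M L" using thoms_lift[OF M L] by blast
  then show "f \<in> fst ` khoms M L" by force
qed

text \<open>Injectivity of f2 follows from that of f0 because \<open>a02\<close> is injective. The
  preimage of \<open>tilde p (Phi p L)\<close> = ker a10 under f0 is the kernel of f1 a10; it equals
  ker a10 of M exactly if f1 is injective, as \<open>a10\<close> is surjective.\<close>

lemma khoms_inj_iff:
  assumes M: "exact_kmod p M" and L: "exact_kmod p L" and f: "(f0, f1, f2) \<in> khoms M L"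
  shows "(inj_on f0 (carrier (KG0 M)) \<and> inj_on f1 (carrier (KG1 M)) \<and> inj_on f2 (carrier (KG2 M)))
    \<longleftrightarrow> (inj_on f0 (carrier (KG0 M)) \<and>
      {x\<in>carrier (KG0 M). f0 x \<in> tilde p (Phi p L)} = tilde p (Phi p M))"
proof -
  interpret M: exact_kmod p M by fact
  interpret L: exact_kmod p L by fact
  note c = khoms_cancel[OF M L f]
  interpret f0: group_hom "KG0 M" "KG0 L" f0 by (rule c(3))
  interpret f1: group_hom "KG1 M" "KG1 L" f1 by (rule c(4))
  interpret f2: group_hom "KG2 M" "KG2 L" f2 by (rule c(5))
  have one: "f1 (a10 M x) = \<one>\<^bsub>KG1 L\<^esub>" if "a10 M x = \<one>\<^bsub>KG1 M\<^esub>" for x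
    using that by simp
  have "inj_on f2 (carrier (KG2 M))" if inj: "inj_on f0 (carrier (KG0 M))"
  proof (rule inj_onI)
    fix x y assume xy: "x \<in> carrier (KG2 M)" "y \<in> carrier (KG2 M)" "f2 x = f2 y"
    then have "f0 (a02 M x) = f0 (a02 M y)" using c(2) by simp
    then have "a02 M x = a02 M y" using inj_onD[OF inj] xy by simp
    then show "x = y" using inj_onD[OF M.a02_inj] xy by simp
  qed
  moreover have "{x\<in>carrier (KG0 M). f0 x \<in> tilde p (Phi p L)} =
      {x\<in>carrier (KG0 M). f1 (a10 M x) = \<one>\<^bsub>KG1 L\<^esub>}"
    unfolding L.tilde_Phi L.image_a02 using c(1) by auto
  moreover have "inj_on f1 (carrier (KG1 M)) \<longleftrightarrow>
      {x\<in>carrier (KG0 M). f1 (a10 M x) = \<one>\<^bsub>KG1 L\<^esub>} = {x\<in>carrier (KG0 M). a10 M x = \<one>\<^bsub>KG1 M\<^esub>}"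
  proof -
    have "inj_on f1 (carrier (KG1 M)) \<longleftrightarrow>
        (\<forall>y\<in>a10 M ` carrier (KG0 M). f1 y = \<one>\<^bsub>KG1 L\<^esub> \<longrightarrow> y = \<one>\<^bsub>KG1 M\<^esub>)"
      unfolding M.a10_surj f1.inj_on_one_iff by blast
    also have "\<dots> \<longleftrightarrow> (\<forall>x\<in>carrier (KG0 M). f1 (a10 M x) = \<one>\<^bsub>KG1 L\<^esub> \<longrightarrow> a10 M x = \<one>\<^bsub>KG1 M\<^esub>)"
      by blast
    finally show ?thesis using one by blast
  qed
  ultimately show ?thesis unfolding M.tilde_Phi M.image_a02 by argo
qed

text \<open>Dual to the injective case: f1 inherits surjectivity from f0 through the surjective
  \<open>a10\<close>, while f2 is detected inside M_0 through the injective
  \<open>a02\<close>.\<close>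

lemma khoms_surj_iff:
  assumes M: "exact_kmod p M" and L: "exact_kmod p L" and f: "(f0, f1, f2) \<in> khoms M L"
  shows "(f0 ` carrier (KG0 M) = carrier (KG0 L) \<and> f1 ` carrier (KG1 M) = carrier (KG1 L) \<and>
      f2 ` carrier (KG2 M) = carrier (KG2 L))
    \<longleftrightarrow> (f0 ` carrier (KG0 M) = carrier (KG0 L) \<and> f0 ` tilde p (Phi p M) = tilde p (Phi p L))"
proof -
  interpret M: exact_kmod p M by fact
  interpret L: exact_kmod p L by fact
  note c = khoms_cancel[OF M L f]
  interpret f2: group_hom "KG2 M" "KG2 L" f2 by (rule c(5))
  have "f1 ` carrier (KG1 M) = carrier (KG1 L)" if "f0 ` carrier (KG0 M) = carrier (KG0 L)"
  proof -
    have "f1 ` carrier (KG1 M) = a10 L ` f0 ` carrier (KG0 M)"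
      unfolding M.a10_surj[symmetric] image_image using c(1) by (intro image_cong) auto
    then show ?thesis using that L.a10_surj by simp
  qed
  moreover have "f0 ` tilde p (Phi p M) = a02 L ` f2 ` carrier (KG2 M)"
    unfolding M.tilde_Phi image_image using c(2) by (intro image_cong) auto
  moreover have "a02 L ` f2 ` carrier (KG2 M) = a02 L ` carrier (KG2 L) \<longleftrightarrow>
      f2 ` carrier (KG2 M) = carrier (KG2 L)"
    by (rule inj_on_image_eq_iff[OF L.a02_inj]) auto
  ultimately show ?thesis unfolding L.tilde_Phi by auto
qed

section \<open>From triples to exact modules\<close>

lemma (in endo) endo_cong:
  assumes "\<And>x. x \<in> carrier G \<Longrightarrow> u x = t x"
  shows "endo G u"
  using assms by unfold_locales (auto intro!: homI simp: t_mult)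

text \<open>\<open>Nop\<close> takes a function on the whole type, while 1 - (1 - t) agrees with t
  on the carrier only. The identity of G intertwines the two.\<close>

lemma (in endo) Nop_cong:
  assumes u: "\<And>x. x \<in> carrier G \<Longrightarrow> u x = t x" and "x \<in> carrier G"
  shows "Nop n G u x = Nop n G t x"
proof -
  have "(\<lambda>x. x) \<in> hom G G" by (rule homI) auto
  then show ?thesis
    using hom_Nop[OF endo_axioms endo_cong[OF u], of "\<lambda>x. x" x n] assms by simp
qed

locale exact_triple =
  fixes p :: nat and T :: "'a ktriple"
  assumes valid: "valid_triple p T"
begin

lemma graded: "graded (TG T) (Tgr T)"
  and gpres_Tt: "gpres (Tt T) (TG T) (Tgr T) (TG T) (Tgr T)"
  and kernel_om: "{x \<in> carrier (TG T). om (TG T) (Tt T) x = \<one>\<^bsub>TG T\<^esub>} = Nop p (TG T) (Tt T) ` carrier (TG T)"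
  and Tal_iso: "Tal T \<in> iso (TH0 p T\<lparr>carrier := TD T\<rparr>) (TH0 p T Mod TD T)"
  using valid by (simp_all add: valid_triple_def)

lemma TD_graded:
  "C \<in> TD T \<Longrightarrow> \<exists>a\<in>TD T \<inter> fst (TH0gr p T). \<exists>b\<in>TD T \<inter> snd (TH0gr p T). C = a \<otimes>\<^bsub>TH0 p T\<^esub> b"
  using valid by (simp add: valid_triple_def)

lemma Tal_grev:
  "Tal T ` (TD T \<inter> hpart i (TH0gr p T)) \<subseteq> hpart (\<not> i) (qgr (TH0 p T) (TD T) (TH0gr p T))"
  using valid by (cases i) (simp_all add: valid_triple_def)

sublocale pretriple p T
proof (intro pretriple.intro cyclic_action.intro endo.intro plain_comm_groupI endo_axioms.intro
    cyclic_action_axioms.intro pretriple_axioms.intro)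
  show "comm_group (TG T)" by (rule gradedD(1)[OF graded])
  show "Tt T \<in> hom (TG T) (TG T)" using gpres_Tt by (simp add: gpres_def)
  show "Tal T C \<in> carrier (TH0 p T Mod TD T)" if "C \<in> TD T" for C
    using Tal_iso that bij_betwE[of "Tal T" "TD T" "carrier (TH0 p T Mod TD T)"] by (simp add: iso_def del: carrier_FactGroup)
qed (use valid in \<open>simp_all add: valid_triple_def\<close>)

lemma om_homogeneous: "x \<in> hpart i (Tgr T) \<Longrightarrow> om (TG T) (Tt T) x \<in> hpart i (Tgr T)"
  unfolding om_def using gradedD(2)[OF graded, of i] gpres_hpart[OF gpres_Tt]
  by (simp add: subgroup.m_closed subgroup.m_inv_closed)

text \<open>Splitting the class of x determines homogeneous representatives only up to im(1-t). The
  error term is split as well: t preserves degrees, so 1 - t maps components to components, and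
  these lie in im(1-t), a part of \<open>tilde p T\<close>.\<close>

lemma tilde_graded: "graded_subset (TG T) (Tgr T) (tilde p T)"
  unfolding graded_subset_def
proof
  fix x assume x: "x \<in> tilde p T"
  note xc = W_closed[OF x]
  have "hcls (TG T) (Tt T) x \<in> TD T" using x by (simp add: tilde_def)
  then obtain A B where AB: "A \<in> TD T \<inter> fst (TH0gr p T)" "B \<in> TD T \<inter> snd (TH0gr p T)"
    "hcls (TG T) (Tt T) x = A \<otimes>\<^bsub>TH0 p T\<^esub> B" using TD_graded by blast
  obtain a where a: "a \<in> fst (Tgr T)" "a \<in> kerN p (TG T) (Tt T)" "A = hcls (TG T) (Tt T) a"
    using AB(1) hpart_H0gr[of False p "TG T" "Tgr T" "Tt T"] by auto
  obtain b where b: "b \<in> snd (Tgr T)" "b \<in> kerN p (TG T) (Tt T)" "B = hcls (TG T) (Tt T) b"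
    using AB(2) hpart_H0gr[of True p "TG T" "Tgr T" "Tt T"] by auto
  have abt: "a \<in> tilde p T" "b \<in> tilde p T" using a b AB by (auto simp: tilde_def)
  note abc = W_closed[OF abt(1)] W_closed[OF abt(2)]
  have "hcls (TG T) (Tt T) x = hcls (TG T) (Tt T) (a \<otimes>\<^bsub>TG T\<^esub> b)"
    using AB(3) a b by (simp only: hcls_mult)
  then have "x \<otimes>\<^bsub>TG T\<^esub> inv\<^bsub>TG T\<^esub> (a \<otimes>\<^bsub>TG T\<^esub> b) \<in> imom (TG T) (Tt T)"
    using hcls_eq_iff[of x "a \<otimes>\<^bsub>TG T\<^esub> b"] xc abc by simp
  then obtain z where z: "z \<in> carrier (TG T)"
    "x \<otimes>\<^bsub>TG T\<^esub> inv\<^bsub>TG T\<^esub> (a \<otimes>\<^bsub>TG T\<^esub> b) = om (TG T) (Tt T) z" by (auto simp: imom_def)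
  obtain c d where cd: "c \<in> hpart False (Tgr T)" "d \<in> hpart (\<not> False) (Tgr T)" "z = c \<otimes>\<^bsub>TG T\<^esub> d"
    using graded_split[OF graded z(1)] .
  have cdc: "c \<in> carrier (TG T)" "d \<in> carrier (TG T)" using cd gradedD(3)[OF graded] by blast+
  let ?c = "om (TG T) (Tt T) c" and ?d = "om (TG T) (Tt T) d"
  have om: "?c \<in> tilde p T" "?d \<in> tilde p T" using cdc imom_subset_W by (auto simp: imom_def)
  have "x = om (TG T) (Tt T) z \<otimes>\<^bsub>TG T\<^esub> (a \<otimes>\<^bsub>TG T\<^esub> b)"
    using inv_solve_right[of "om (TG T) (Tt T) z" x "a \<otimes>\<^bsub>TG T\<^esub> b"] z xc abc by simp
  also have "\<dots> = (?c \<otimes>\<^bsub>TG T\<^esub> ?d) \<otimes>\<^bsub>TG T\<^esub> (a \<otimes>\<^bsub>TG T\<^esub> b)"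
    using cd(3) hom_mult[OF om_hom cdc] by simp
  also have "\<dots> = (?c \<otimes>\<^bsub>TG T\<^esub> a) \<otimes>\<^bsub>TG T\<^esub> (?d \<otimes>\<^bsub>TG T\<^esub> b)"
    using cdc abc om_closed by (simp add: m_ac)
  finally have "x = (?c \<otimes>\<^bsub>TG T\<^esub> a) \<otimes>\<^bsub>TG T\<^esub> (?d \<otimes>\<^bsub>TG T\<^esub> b)" .
  moreover have "?c \<otimes>\<^bsub>TG T\<^esub> a \<in> tilde p T \<inter> fst (Tgr T)"
    using om_homogeneous[OF cd(1)] om a abt gradedD(2)[OF graded, of False] W_subgroup
    by (simp add: subgroup.m_closed)
  moreover have "?d \<otimes>\<^bsub>TG T\<^esub> b \<in> tilde p T \<inter> snd (Tgr T)"
    using om_homogeneous[OF cd(2)] om b abt gradedD(2)[OF graded, of True] W_subgroup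
    by (simp add: subgroup.m_closed)
  ultimately show "\<exists>a\<in>tilde p T \<inter> fst (Tgr T). \<exists>b\<in>tilde p T \<inter> snd (Tgr T). x = a \<otimes>\<^bsub>TG T\<^esub> b"
    by blast
qed

text \<open>An element of the iterated quotient by the image of \<open>1 - t\<close> and then by the subspace is a
  set of cosets; its union is a coset of \<^term>\<open>tilde p T\<close>.\<close>

definition al :: "'a \<Rightarrow> 'a set" where
  "al x = \<Union> (Tal T (hcls (TG T) (Tt T) x))"

lemma dcls_T_eq_iff:
  assumes "y \<in> kerN p (TG T) (Tt T)" "z \<in> kerN p (TG T) (Tt T)"
  shows "dcls p (TG T) (Tt T) (TD T) y = dcls p (TG T) (Tt T) (TD T) z \<longleftrightarrow>
    tilde p T #>\<^bsub>TG T\<^esub> y = tilde p T #>\<^bsub>TG T\<^esub> z"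
  using dcls_eq_iff[OF assms] rcos_eq_iff[OF W_subgroup, of y z] assms kerN_closed unfolding TD_eq by simp

lemma rel_al_exists:
  assumes "x \<in> tilde p T" obtains y where "rel_al p T x y"
  using Tal_dcls[OF assms] assms by (metis rel_al_def)

lemma rel_al_al: "rel_al p T x y \<Longrightarrow> al x = tilde p T #>\<^bsub>TG T\<^esub> y"
  using Union_dcls[of y] unfolding al_def rel_al_def TD_eq by simp

lemma rel_al_closed:
  assumes "rel_al p T x y"
  shows "x \<in> tilde p T" "x \<in> carrier (TG T)" "y \<in> kerN p (TG T) (Tt T)" "y \<in> carrier (TG T)"
  using assms W_closed kerN_closed by (auto simp: rel_al_def)

text \<open>Flattening loses nothing: two iterated cosets with the same union coincide, so
  \<open>al\<close> carries the same information as \<open>Tal\<close>.\<close>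

lemma rel_al_iff:
  "rel_al p T x y \<longleftrightarrow> x \<in> tilde p T \<and> y \<in> kerN p (TG T) (Tt T) \<and> al x = tilde p T #>\<^bsub>TG T\<^esub> y"
proof
  assume "rel_al p T x y"
  then show "x \<in> tilde p T \<and> y \<in> kerN p (TG T) (Tt T) \<and> al x = tilde p T #>\<^bsub>TG T\<^esub> y"
    using rel_al_al rel_al_closed by blast
next
  assume *: "x \<in> tilde p T \<and> y \<in> kerN p (TG T) (Tt T) \<and> al x = tilde p T #>\<^bsub>TG T\<^esub> y"
  then obtain z where z: "rel_al p T x z" using rel_al_exists by blast
  then have "dcls p (TG T) (Tt T) (TD T) y = dcls p (TG T) (Tt T) (TD T) z"
    using * rel_al_al[OF z] rel_al_closed[OF z] by (simp add: dcls_T_eq_iff)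
  then show "rel_al p T x y" using * z by (simp add: rel_al_def)
qed

lemma rel_al_mult:
  assumes "rel_al p T x y" "rel_al p T u v"
  shows "rel_al p T (x \<otimes>\<^bsub>TG T\<^esub> u) (y \<otimes>\<^bsub>TG T\<^esub> v)"
proof -
  note c = rel_al_closed[OF assms(1)] and d = rel_al_closed[OF assms(2)]
  have D: "hcls (TG T) (Tt T) x \<in> TD T" "hcls (TG T) (Tt T) u \<in> TD T"
    using c d by (auto simp: tilde_def)
  have "Tal T (hcls (TG T) (Tt T) (x \<otimes>\<^bsub>TG T\<^esub> u)) =
      Tal T (hcls (TG T) (Tt T) x \<otimes>\<^bsub>TH0 p T\<^esub> hcls (TG T) (Tt T) u)"
    using c(1) d(1) W_subset_kerN by (subst hcls_mult) auto
  also have "\<dots> = Tal T (hcls (TG T) (Tt T) x) \<otimes>\<^bsub>TH0 p T Mod TD T\<^esub> Tal T (hcls (TG T) (Tt T) u)"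
    using hom_mult[of "Tal T" "TH0 p T\<lparr>carrier := TD T\<rparr>" "TH0 p T Mod TD T"] Tal_iso D
    by (simp add: iso_def del: mult_FactGroup)
  also have "\<dots> = dcls p (TG T) (Tt T) (TD T) (y \<otimes>\<^bsub>TG T\<^esub> v)"
    using dcls_mult[OF c(3) d(3)] assms unfolding TD_eq by (simp add: rel_al_def)
  finally show ?thesis
    using c d W_subgroup kerN_subgroup by (simp add: rel_al_def subgroup.m_closed)
qed

lemma al_closed: "x \<in> tilde p T \<Longrightarrow> al x \<in> carrier (TG T Mod tilde p T)"
proof -
  assume "x \<in> tilde p T"
  then obtain y where y: "rel_al p T x y" by (rule rel_al_exists)
  then show ?thesis using rel_al_al[OF y] rel_al_closed[OF y] by (auto simp: FactGroup_def RCOSETS_def)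
qed

lemma al_mult:
  assumes "x \<in> tilde p T" "u \<in> tilde p T"
  shows "al (x \<otimes>\<^bsub>TG T\<^esub> u) = al x \<otimes>\<^bsub>TG T Mod tilde p T\<^esub> al u"
proof -
  obtain y where y: "rel_al p T x y" using assms(1) by (rule rel_al_exists)
  obtain v where v: "rel_al p T u v" using assms(2) by (rule rel_al_exists)
  show ?thesis
    using rel_al_al[OF y] rel_al_al[OF v] rel_al_al[OF rel_al_mult[OF y v]]
      hom_mult[OF rcos_hom[OF W_subgroup]] rel_al_closed[OF y] rel_al_closed[OF v] by simp
qed

lemma al_hom: "al \<in> hom (TG T\<lparr>carrier := tilde p T\<rparr>) (TG T Mod tilde p T)"
proof (rule homI)
  show "al x \<in> carrier (TG T Mod tilde p T)" if "x \<in> carrier (TG T\<lparr>carrier := tilde p T\<rparr>)" for x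
    using al_closed that by simp
  show "al (x \<otimes>\<^bsub>TG T\<lparr>carrier := tilde p T\<rparr>\<^esub> y) = al x \<otimes>\<^bsub>TG T Mod tilde p T\<^esub> al y"
    if "x \<in> carrier (TG T\<lparr>carrier := tilde p T\<rparr>)" "y \<in> carrier (TG T\<lparr>carrier := tilde p T\<rparr>)" for x y
    using al_mult that by (simp del: mult_FactGroup)
qed

sublocale W: plain_comm_group "TG T\<lparr>carrier := tilde p T\<rparr>"
  by (rule plain_comm_groupI[OF subgroup_comm_group[OF W_subgroup]])

sublocale Q: plain_comm_group "TG T Mod tilde p T"
  by (rule plain_comm_groupI[OF abelian_FactGroup[OF W_subgroup]])

sublocale al: group_hom "TG T\<lparr>carrier := tilde p T\<rparr>" "TG T Mod tilde p T" al
  by unfold_locales (rule al_hom)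

sublocale q: group_hom "TG T" "TG T Mod tilde p T" "\<lambda>x. tilde p T #>\<^bsub>TG T\<^esub> x"
  by unfold_locales (rule rcos_hom[OF W_subgroup])

lemma carrier_Q: "carrier (TG T Mod tilde p T) = (\<lambda>x. tilde p T #>\<^bsub>TG T\<^esub> x) ` carrier (TG T)"
  by (auto simp: FactGroup_def RCOSETS_def)

lemma rcos_tilde_one_iff:
  "x \<in> carrier (TG T) \<Longrightarrow> tilde p T #>\<^bsub>TG T\<^esub> x = tilde p T \<longleftrightarrow> x \<in> tilde p T"
  using rcos_eq_iff[OF W_subgroup, of x "\<one>\<^bsub>TG T\<^esub>"] subgroup.subset[OF W_subgroup]
  by (simp add: coset_mult_one)

text \<open>Injectivity of \<open>Tal\<close> on representatives; it becomes exactness at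
  M_2.\<close>

lemma al_one_iff:
  assumes x: "x \<in> tilde p T"
  shows "al x = tilde p T \<longleftrightarrow> x \<in> imom (TG T) (Tt T)"
proof -
  have one: "\<one>\<^bsub>TG T\<^esub> \<in> tilde p T" by (rule subgroup.one_closed[OF W_subgroup])
  have al1: "al \<one>\<^bsub>TG T\<^esub> = tilde p T" using al.hom_one by simp
  have eq_iff: "al u = al v \<longleftrightarrow> hcls (TG T) (Tt T) u = hcls (TG T) (Tt T) v"
    if u: "u \<in> tilde p T" and v: "v \<in> tilde p T" for u v
  proof
    assume "hcls (TG T) (Tt T) u = hcls (TG T) (Tt T) v"
    then show "al u = al v" by (simp add: al_def)
  next
    assume al: "al u = al v"
    obtain y where y: "rel_al p T u y" using u by (rule rel_al_exists)
    then have "rel_al p T v y" using al v by (simp add: rel_al_iff)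
    then have "Tal T (hcls (TG T) (Tt T) u) = Tal T (hcls (TG T) (Tt T) v)"
      using y by (simp add: rel_al_def)
    moreover have "inj_on (Tal T) (TD T)" using Tal_iso by (simp add: iso_def bij_betw_def)
    ultimately show "hcls (TG T) (Tt T) u = hcls (TG T) (Tt T) v"
      using u v by (elim inj_onD) (simp_all add: tilde_def)
  qed
  have "al x = tilde p T \<longleftrightarrow> hcls (TG T) (Tt T) x = hcls (TG T) (Tt T) \<one>\<^bsub>TG T\<^esub>"
    using eq_iff[OF x one] al1 by simp
  also have "\<dots> \<longleftrightarrow> x \<in> imom (TG T) (Tt T)"
    using x W_closed by (subst hcls_eq_iff) auto
  finally show ?thesis .
qed

text \<open>Surjectivity of \<open>Tal\<close> on representatives; it becomes exactness at M_1,
  where ker a01 consists of the cosets of ker N(t).\<close>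

lemma al_surj:
  assumes y: "y \<in> kerN p (TG T) (Tt T)"
  obtains x where "x \<in> tilde p T" "al x = tilde p T #>\<^bsub>TG T\<^esub> y"
proof -
  have "dcls p (TG T) (Tt T) (TD T) y \<in> carrier (TH0 p T Mod TD T)"
    using carrier_H0_Mod y unfolding TD_eq by blast
  then have "dcls p (TG T) (Tt T) (TD T) y \<in> Tal T ` TD T"
    using Tal_iso by (auto simp: iso_def bij_betw_def)
  then obtain C where C: "C \<in> TD T" "Tal T C = dcls p (TG T) (Tt T) (TD T) y" by auto
  obtain x where "x \<in> tilde p T" "C = hcls (TG T) (Tt T) x" using C(1) unfolding TD_eq[symmetric] by blast
  with C(2) have "x \<in> tilde p T" "Tal T (hcls (TG T) (Tt T) x) = dcls p (TG T) (Tt T) (TD T) y" by simp_all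
  then have "rel_al p T x y" using y by (simp add: rel_al_def)
  then show ?thesis using that rel_al_iff by blast
qed

lemma al_grev:
  "grev al (TG T\<lparr>carrier := tilde p T\<rparr>) (fst (Tgr T) \<inter> tilde p T, snd (Tgr T) \<inter> tilde p T)
    (TG T Mod tilde p T) (qgr (TG T) (tilde p T) (Tgr T))"
  unfolding grev_iff hpart_Int hpart_qgr
proof (intro conjI allI al_hom image_subsetI)
  fix i x assume x: "x \<in> hpart i (Tgr T) \<inter> tilde p T"
  then have "x \<in> hpart i (Tgr T) \<inter> kerN p (TG T) (Tt T)" "hcls (TG T) (Tt T) x \<in> TD T"
    by (simp_all add: tilde_def)
  then have "hcls (TG T) (Tt T) x \<in> TD T \<inter> hpart i (TH0gr p T)"
    unfolding hpart_H0gr by (intro IntI imageI) simp_all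
  then have "Tal T (hcls (TG T) (Tt T) x) \<in> hpart (\<not> i) (qgr (TH0 p T) (TD T) (TH0gr p T))"
    using Tal_grev by (meson imageI subsetD)
  then obtain y where y: "y \<in> hpart (\<not> i) (Tgr T)" "y \<in> kerN p (TG T) (Tt T)"
    "Tal T (hcls (TG T) (Tt T) x) = dcls p (TG T) (Tt T) (TD T) y"
    unfolding hpart_qgr hpart_H0gr image_image by (elim imageE IntE)
  then have "rel_al p T x y" using x by (simp add: rel_al_def)
  then have "al x = tilde p T #>\<^bsub>TG T\<^esub> y" by (rule rel_al_al)
  then show "al x \<in> (\<lambda>a. tilde p T #>\<^bsub>TG T\<^esub> a) ` hpart (\<not> i) (Tgr T)"
    using y(1) by (rule image_eqI)
qed

section \<open>The exact module of a triple\<close>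

definition module :: "('a, 'a set, 'a) kmod" where
  "module = \<lparr>
     KG0 = TG T, Kgr0 = Tgr T,
     KG1 = TG T Mod tilde p T, Kgr1 = qgr (TG T) (tilde p T) (Tgr T),
     KG2 = TG T\<lparr>carrier := tilde p T\<rparr>, Kgr2 = (fst (Tgr T) \<inter> tilde p T, snd (Tgr T) \<inter> tilde p T),
     a01 = (\<lambda>C. Nop p (TG T) (Tt T) (SOME x. x \<in> C)), a02 = (\<lambda>x. x),
     a10 = (\<lambda>x. tilde p T #>\<^bsub>TG T\<^esub> x), a12 = al,
     a20 = om (TG T) (Tt T), a21 = (\<lambda>_. \<one>\<^bsub>TG T\<^esub>)\<rparr>"

lemma module_simps [simp]:
  "KG0 module = TG T" "Kgr0 module = Tgr T"
  "KG1 module = TG T Mod tilde p T" "Kgr1 module = qgr (TG T) (tilde p T) (Tgr T)"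
  "KG2 module = TG T\<lparr>carrier := tilde p T\<rparr>"
  "Kgr2 module = (fst (Tgr T) \<inter> tilde p T, snd (Tgr T) \<inter> tilde p T)"
  "a02 module = (\<lambda>x. x)" "a10 module = (\<lambda>x. tilde p T #>\<^bsub>TG T\<^esub> x)" "a12 module = al"
  "a20 module = om (TG T) (Tt T)" "a21 module = (\<lambda>_. \<one>\<^bsub>TG T\<^esub>)"
  by (simp_all add: module_def)

lemma one_tilde: "\<one>\<^bsub>TG T\<^esub> \<in> tilde p T"
  by (rule subgroup.one_closed[OF W_subgroup])

lemma om_tilde: "x \<in> carrier (TG T) \<Longrightarrow> om (TG T) (Tt T) x \<in> tilde p T"
  using imom_subset_W by (auto simp: imom_def)

lemma Nop_tilde: "x \<in> tilde p T \<Longrightarrow> Nop p (TG T) (Tt T) x = \<one>\<^bsub>TG T\<^esub>"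
  using W_subset_kerN by (auto simp: kerN_def)

text \<open>N(t) vanishes on \<open>tilde p T\<close>, so evaluating it on an arbitrarily chosen
  element of the coset does no harm.\<close>

lemma a01_module:
  assumes "x \<in> carrier (TG T)"
  shows "a01 module (tilde p T #>\<^bsub>TG T\<^esub> x) = Nop p (TG T) (Tt T) x"
proof -
  define z where "z = (SOME z. z \<in> tilde p T #>\<^bsub>TG T\<^esub> x)"
  have "z \<in> tilde p T #>\<^bsub>TG T\<^esub> x"
    unfolding z_def using rcos_self[OF assms W_subgroup] by (rule someI)
  then obtain w where w: "w \<in> tilde p T" "z = w \<otimes>\<^bsub>TG T\<^esub> x" by (auto simp: r_coset_def)
  then have "Nop p (TG T) (Tt T) z = Nop p (TG T) (Tt T) x"
    using hom_mult[OF Nop_hom W_closed[OF w(1)] assms, of p] assms by (simp add: Nop_tilde)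
  then show ?thesis by (simp add: module_def z_def)
qed

lemma m_inv_tilde: "x \<in> tilde p T \<Longrightarrow> inv\<^bsub>TG T\<lparr>carrier := tilde p T\<rparr>\<^esub> x = inv\<^bsub>TG T\<^esub> x"
  by (rule m_inv_consistent[OF W_subgroup])

lemma om_om: "x \<in> carrier (TG T) \<Longrightarrow> om (TG T) (om (TG T) (Tt T)) x = Tt T x"
  by (simp add: om_def inv_mult m_assoc[symmetric])

lemma kt0_module: "x \<in> carrier (TG T) \<Longrightarrow> kt0 module x = Tt T x"
  by (simp add: kt0_def comp_def om_om)

lemma Tt_tilde: "x \<in> tilde p T \<Longrightarrow> Tt T x \<in> tilde p T"
proof -
  assume x: "x \<in> tilde p T"
  have "inv\<^bsub>TG T\<^esub> (om (TG T) (Tt T) x) \<otimes>\<^bsub>TG T\<^esub> x \<in> tilde p T"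
    using x om_tilde[OF W_closed[OF x]] W_subgroup by (simp add: subgroup.m_closed subgroup.m_inv_closed)
  also have "inv\<^bsub>TG T\<^esub> (om (TG T) (Tt T) x) \<otimes>\<^bsub>TG T\<^esub> x = Tt T x"
    using W_closed[OF x] inv_solve_left'[of "Tt T x" "om (TG T) (Tt T) x" x] by (simp add: om_def m_assoc)
  finally show ?thesis .
qed

lemma rcos_Tt: "x \<in> carrier (TG T) \<Longrightarrow> tilde p T #>\<^bsub>TG T\<^esub> Tt T x = tilde p T #>\<^bsub>TG T\<^esub> x"
  using om_tilde[of x] by (subst eq_commute) (simp add: rcos_eq_iff[OF W_subgroup] om_def)

text \<open>Modulo \<open>tilde p T\<close>, which contains im(1-t), t is the identity and N(t) is
  multiplication by n. For n = p this is the relation a10 a01 = N(s_1) with s_1 = 1.\<close>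

lemma rcos_Nop:
  assumes "x \<in> carrier (TG T)"
  shows "tilde p T #>\<^bsub>TG T\<^esub> Nop n (TG T) (Tt T) x = (tilde p T #>\<^bsub>TG T\<^esub> x) [^]\<^bsub>TG T Mod tilde p T\<^esub> n"
proof -
  have "tilde p T #>\<^bsub>TG T\<^esub> Nop n (TG T) (Tt T) x =
      Nop n (TG T Mod tilde p T) (\<lambda>C. C) (tilde p T #>\<^bsub>TG T\<^esub> x)"
    by (rule hom_Nop[OF endo_axioms Q.endo_id q.homh]) (auto simp: rcos_Tt assms)
  also have "\<dots> = (tilde p T #>\<^bsub>TG T\<^esub> x) [^]\<^bsub>TG T Mod tilde p T\<^esub> n"
    by (rule Q.Nop_id) (use q.hom_closed[OF assms] in auto)
  finally show ?thesis .
qed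

text \<open>This gives N(t_2) = 0, since \<open>tilde p T\<close> lies in ker N(t). The variable u
  stands for t_2, an expression in the restricted group that agrees with t on
  \<open>tilde p T\<close>.\<close>

lemma tilde_Nop:
  assumes u: "\<And>x. x \<in> tilde p T \<Longrightarrow> u x = Tt T x" and x: "x \<in> tilde p T"
  shows "Nop p (TG T\<lparr>carrier := tilde p T\<rparr>) u x = \<one>\<^bsub>TG T\<^esub>"
proof -
  have inc: "(\<lambda>x. x) \<in> hom (TG T\<lparr>carrier := tilde p T\<rparr>) (TG T)"
    by (rule homI) (auto simp: W_closed)
  have u_endo: "endo (TG T\<lparr>carrier := tilde p T\<rparr>) u"
  proof
    show "u \<in> hom (TG T\<lparr>carrier := tilde p T\<rparr>) (TG T\<lparr>carrier := tilde p T\<rparr>)"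
      using subgroup.m_closed[OF W_subgroup]
      by (intro homI) (auto simp: u Tt_tilde t_mult W_closed)
  qed
  have "Nop p (TG T\<lparr>carrier := tilde p T\<rparr>) u x = Nop p (TG T) (Tt T) x"
    using hom_Nop[OF u_endo endo_axioms inc, of x p] u x by simp
  then show ?thesis using x by (simp add: Nop_tilde)
qed

lemma a01_module_hom: "a01 module \<in> hom (TG T Mod tilde p T) (TG T)"
proof (rule homI)
  fix C D assume "C \<in> carrier (TG T Mod tilde p T)" "D \<in> carrier (TG T Mod tilde p T)"
  then obtain x y where "x \<in> carrier (TG T)" "y \<in> carrier (TG T)"
    "C = tilde p T #>\<^bsub>TG T\<^esub> x" "D = tilde p T #>\<^bsub>TG T\<^esub> y" by (auto simp only: carrier_Q)
  then show "a01 module (C \<otimes>\<^bsub>TG T Mod tilde p T\<^esub> D) = a01 module C \<otimes>\<^bsub>TG T\<^esub> a01 module D"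
    using q.hom_mult[of x y] hom_mult[OF Nop_hom, of x y p] a01_module[of x] a01_module[of y]
      a01_module[of "x \<otimes>\<^bsub>TG T\<^esub> y"] by (simp del: mult_FactGroup)
next
  fix C assume "C \<in> carrier (TG T Mod tilde p T)"
  then obtain x where "x \<in> carrier (TG T)" "C = tilde p T #>\<^bsub>TG T\<^esub> x" by (auto simp only: carrier_Q)
  then show "a01 module C \<in> carrier (TG T)" by (simp add: a01_module)
qed

lemma Nop_homogeneous:
  assumes "x \<in> hpart i (Tgr T)"
  shows "Nop n (TG T) (Tt T) x \<in> hpart i (Tgr T)"
proof -
  interpret S: subgroup "hpart i (Tgr T)" "TG T" by (rule gradedD(2)[OF graded])
  have pow: "(Tt T ^^ m) x \<in> hpart i (Tgr T)" for m
    using assms by (induction m) (auto intro: gpres_hpart[OF gpres_Tt])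
  show ?thesis using assms S.one_closed pow by (induction n) (simp_all add: Nop_Suc)
qed

lemma gpres_a01_module:
  "gpres (a01 module) (TG T Mod tilde p T) (qgr (TG T) (tilde p T) (Tgr T)) (TG T) (Tgr T)"
  unfolding gpres_iff hpart_qgr
proof (intro conjI allI a01_module_hom image_subsetI)
  fix i C assume "C \<in> (\<lambda>a. tilde p T #>\<^bsub>TG T\<^esub> a) ` hpart i (Tgr T)"
  then obtain x where x: "x \<in> hpart i (Tgr T)" "C = tilde p T #>\<^bsub>TG T\<^esub> x" by auto
  then show "a01 module C \<in> hpart i (Tgr T)"
    using a01_module[of x] Nop_homogeneous[OF x(1)] gradedD(3)[OF graded, of i] by auto
qed

lemma om_mult:
  "x \<in> carrier (TG T) \<Longrightarrow> y \<in> carrier (TG T) \<Longrightarrow>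
    om (TG T) (Tt T) (x \<otimes>\<^bsub>TG T\<^esub> y) = om (TG T) (Tt T) x \<otimes>\<^bsub>TG T\<^esub> om (TG T) (Tt T) y"
  by (rule hom_mult[OF om_hom])

lemma kmodule_module: "kmodule p module"
  unfolding kmodule_def module_simps
proof (intro conjI ballI)
  show "graded (TG T) (Tgr T)" by (rule graded)
  show "graded (TG T Mod tilde p T) (qgr (TG T) (tilde p T) (Tgr T))"
    by (rule graded_quotient[OF graded W_subgroup tilde_graded])
  show "graded (TG T\<lparr>carrier := tilde p T\<rparr>) (fst (Tgr T) \<inter> tilde p T, snd (Tgr T) \<inter> tilde p T)"
    by (rule graded_subgroup[OF graded W_subgroup tilde_graded])
  show "gpres (\<lambda>x. tilde p T #>\<^bsub>TG T\<^esub> x) (TG T) (Tgr T) (TG T Mod tilde p T) (qgr (TG T) (tilde p T) (Tgr T))"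
    unfolding gpres_iff hpart_qgr using q.homh by blast
  show "gpres (a01 module) (TG T Mod tilde p T) (qgr (TG T) (tilde p T) (Tgr T)) (TG T) (Tgr T)"
    by (rule gpres_a01_module)
  show "gpres (\<lambda>x. x) (TG T\<lparr>carrier := tilde p T\<rparr>) (fst (Tgr T) \<inter> tilde p T, snd (Tgr T) \<inter> tilde p T)
      (TG T) (Tgr T)"
    unfolding gpres_iff hpart_Int by (auto intro!: homI simp: W_closed)
  show "gpres (om (TG T) (Tt T)) (TG T) (Tgr T) (TG T\<lparr>carrier := tilde p T\<rparr>)
      (fst (Tgr T) \<inter> tilde p T, snd (Tgr T) \<inter> tilde p T)"
    unfolding gpres_iff hpart_Int
  proof (intro conjI allI image_subsetI IntI homI)
    fix i x assume "x \<in> hpart i (Tgr T)"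
    then show "om (TG T) (Tt T) x \<in> hpart i (Tgr T)" "om (TG T) (Tt T) x \<in> tilde p T"
      using om_homogeneous om_tilde gradedD(3)[OF graded, of i] by auto
  qed (simp_all add: om_tilde om_mult)
  show "grev al (TG T\<lparr>carrier := tilde p T\<rparr>) (fst (Tgr T) \<inter> tilde p T, snd (Tgr T) \<inter> tilde p T)
      (TG T Mod tilde p T) (qgr (TG T) (tilde p T) (Tgr T))"
    by (rule al_grev)
  show "grev (\<lambda>_. \<one>\<^bsub>TG T\<^esub>) (TG T Mod tilde p T) (qgr (TG T) (tilde p T) (Tgr T))
      (TG T\<lparr>carrier := tilde p T\<rparr>) (fst (Tgr T) \<inter> tilde p T, snd (Tgr T) \<inter> tilde p T)"
    unfolding grev_iff hpart_Int
    by (auto intro!: homI simp: one_tilde subgroup.one_closed[OF gradedD(2)[OF graded]])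
next
  fix x assume x: "x \<in> carrier (TG T\<lparr>carrier := tilde p T\<rparr>)"
  then have xt: "x \<in> tilde p T" by simp
  obtain y where y: "rel_al p T x y" using xt by (rule rel_al_exists)
  show "a01 module (al x) = \<one>\<^bsub>TG T\<^esub>"
    unfolding rel_al_al[OF y] a01_module[OF rel_al_closed(4)[OF y]]
    using rel_al_closed(3)[OF y] by (simp add: kerN_def)
  show "tilde p T #>\<^bsub>TG T\<^esub> x = \<one>\<^bsub>TG T Mod tilde p T\<^esub>"
    using rcos_tilde_one_iff[OF W_closed[OF xt]] xt by simp
  have 1: "Nop p (TG T\<lparr>carrier := tilde p T\<rparr>)
      (om (TG T\<lparr>carrier := tilde p T\<rparr>) (om (TG T) (Tt T) \<circ> (\<lambda>x. x))) x = \<one>\<^bsub>TG T\<^esub>"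
  proof (rule tilde_Nop[OF _ xt])
    fix z assume z: "z \<in> tilde p T"
    then show "om (TG T\<lparr>carrier := tilde p T\<rparr>) (om (TG T) (Tt T) \<circ> (\<lambda>x. x)) z = Tt T z"
      using om_om[OF W_closed[OF z]] om_tilde[OF W_closed[OF z]]
      by (simp add: om_def m_inv_tilde)
  qed
  \<comment> \<open>Here s_2 = 1 because \<open>a21\<close> is zero, so the relation N(t_2) + N(s_2)
    = p becomes 0 + p = p.\<close>
  have 2: "Nop p (TG T\<lparr>carrier := tilde p T\<rparr>)
      (om (TG T\<lparr>carrier := tilde p T\<rparr>) ((\<lambda>_. \<one>\<^bsub>TG T\<^esub>) \<circ> al)) x = x [^]\<^bsub>TG T\<lparr>carrier := tilde p T\<rparr>\<^esub> p"
    using xt by (intro W.Nop_id) (simp_all add: om_def m_inv_tilde one_tilde W_closed)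
  show "Nop p (TG T\<lparr>carrier := tilde p T\<rparr>)
         (om (TG T\<lparr>carrier := tilde p T\<rparr>) (om (TG T) (Tt T) \<circ> (\<lambda>x. x))) x
        \<otimes>\<^bsub>TG T\<lparr>carrier := tilde p T\<rparr>\<^esub>
        Nop p (TG T\<lparr>carrier := tilde p T\<rparr>)
         (om (TG T\<lparr>carrier := tilde p T\<rparr>) ((\<lambda>_. \<one>\<^bsub>TG T\<^esub>) \<circ> al)) x =
        x [^]\<^bsub>TG T\<lparr>carrier := tilde p T\<rparr>\<^esub> p"
    unfolding 1 2 using W.nat_pow_closed[OF x, of p] W_closed by simp
next
  fix C assume "C \<in> carrier (TG T Mod tilde p T)"
  then obtain x where x: "x \<in> carrier (TG T)" "C = tilde p T #>\<^bsub>TG T\<^esub> x" by (auto simp only: carrier_Q)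
  \<comment> \<open>The relation a20 a01 = 0 is the inclusion of im N(t) in ker(1-t).\<close>
  show "om (TG T) (Tt T) (a01 module C) = \<one>\<^bsub>TG T\<lparr>carrier := tilde p T\<rparr>\<^esub>"
    using x kernel_om by (auto simp: a01_module)
  have al1: "al \<one>\<^bsub>TG T\<^esub> = \<one>\<^bsub>TG T Mod tilde p T\<^esub>" using al.hom_one by simp
  have id: "om (TG T Mod tilde p T) (al \<circ> (\<lambda>_. \<one>\<^bsub>TG T\<^esub>)) D = D"
    if "D \<in> carrier (TG T Mod tilde p T)" for D
    unfolding om_def comp_def al1 using Q.r_one[OF that] Q.inv_one by simp
  have "Nop p (TG T Mod tilde p T) (om (TG T Mod tilde p T) (al \<circ> (\<lambda>_. \<one>\<^bsub>TG T\<^esub>))) C = C [^]\<^bsub>TG T Mod tilde p T\<^esub> p"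
    by (rule Q.Nop_id[OF id]) (use x carrier_Q in auto)
  then show "tilde p T #>\<^bsub>TG T\<^esub> a01 module C =
      Nop p (TG T Mod tilde p T) (om (TG T Mod tilde p T) (al \<circ> (\<lambda>_. \<one>\<^bsub>TG T\<^esub>))) C"
    using x rcos_Nop[OF x(1), of p] by (simp add: a01_module)
next
  fix x assume x: "x \<in> carrier (TG T)"
  show "al (om (TG T) (Tt T) x) = \<one>\<^bsub>TG T Mod tilde p T\<^esub>"
    using al_one_iff[OF om_tilde[OF x]] x by (simp add: imom_def)
  show "\<one>\<^bsub>TG T\<^esub> = \<one>\<^bsub>TG T\<lparr>carrier := tilde p T\<rparr>\<^esub>" by simp
  show "a01 module (tilde p T #>\<^bsub>TG T\<^esub> x) = Nop p (TG T) (om (TG T) ((\<lambda>x. x) \<circ> om (TG T) (Tt T))) x"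
    using x by (subst Nop_cong[where u = "om (TG T) ((\<lambda>x. x) \<circ> om (TG T) (Tt T))"])
      (simp_all add: comp_def om_om a01_module)
qed simp_all

text \<open>The first sequence is the short exact sequence of \<open>tilde p T\<close> in M_0. In
  the second, exactness at M_2 and M_1 is injectivity and surjectivity of the isomorphism, and
  exactness at M_0 is ker(1-t) = im N(t).\<close>

lemma kexact_module: "kexact module"
  unfolding kexact_def module_simps
proof (intro conjI)
  show "(\<lambda>x. tilde p T #>\<^bsub>TG T\<^esub> x) ` carrier (TG T) =
      {y \<in> carrier (TG T Mod tilde p T). \<one>\<^bsub>TG T\<^esub> = \<one>\<^bsub>TG T\<lparr>carrier := tilde p T\<rparr>\<^esub>}"
    unfolding carrier_Q by simp
  show "(\<lambda>_. \<one>\<^bsub>TG T\<^esub>) ` carrier (TG T Mod tilde p T) =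
      {z \<in> carrier (TG T\<lparr>carrier := tilde p T\<rparr>). z = \<one>\<^bsub>TG T\<^esub>}"
    unfolding carrier_Q using one_tilde one_closed by auto
  show "(\<lambda>x. x) ` carrier (TG T\<lparr>carrier := tilde p T\<rparr>) =
      {x \<in> carrier (TG T). tilde p T #>\<^bsub>TG T\<^esub> x = \<one>\<^bsub>TG T Mod tilde p T\<^esub>}"
    using rcos_tilde_one_iff W_closed by auto
  show "om (TG T) (Tt T) ` carrier (TG T) =
      {z \<in> carrier (TG T\<lparr>carrier := tilde p T\<rparr>). al z = \<one>\<^bsub>TG T Mod tilde p T\<^esub>}"
    using al_one_iff imom_subset_W by (auto simp: imom_def)
  show "al ` carrier (TG T\<lparr>carrier := tilde p T\<rparr>) =
      {y \<in> carrier (TG T Mod tilde p T). a01 module y = \<one>\<^bsub>TG T\<^esub>}" (is "_ = ?R")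
  proof (intro subset_antisym subsetI)
    fix C assume "C \<in> al ` carrier (TG T\<lparr>carrier := tilde p T\<rparr>)"
    then obtain x where x: "x \<in> tilde p T" "C = al x" by auto
    then show "C \<in> ?R" using kmodule_module al_closed[OF x(1)] by (simp add: kmodule_def)
  next
    fix C assume C: "C \<in> ?R"
    then obtain y where y: "y \<in> carrier (TG T)" "C = tilde p T #>\<^bsub>TG T\<^esub> y" by (auto simp only: carrier_Q)
    then have "y \<in> kerN p (TG T) (Tt T)" using C by (simp add: a01_module kerN_def)
    then obtain x where "x \<in> tilde p T" "al x = C" using al_surj y by metis
    then show "C \<in> al ` carrier (TG T\<lparr>carrier := tilde p T\<rparr>)" by auto
  qed
  show "a01 module ` carrier (TG T Mod tilde p T) =
      {x \<in> carrier (TG T). om (TG T) (Tt T) x = \<one>\<^bsub>TG T\<lparr>carrier := tilde p T\<rparr>\<^esub>}"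
    unfolding carrier_Q image_image using kernel_om by (simp add: a01_module)
qed

sublocale module: exact_kmod p module
  by unfold_locales (simp add: kexact0_def kmodule_module kexact_module)

lemma tilde_module: "tilde p (Phi p module) = tilde p T"
  unfolding module.tilde_Phi by simp

text \<open>With \<open>a02\<close> the inclusion, \<open>a10\<close> the projection and
  \<open>a12\<close> equal to \<open>al\<close>, the description by structure maps is the flattened
  description of the given relation; y lies in ker N(t) because a01 a12 = 0.\<close>

lemma rel_al_module: "rel_al p (Phi p module) x y \<longleftrightarrow> rel_al p T x y"
proof
  assume "rel_al p (Phi p module) x y"
  then have y: "y \<in> carrier (TG T)" "x \<in> tilde p T" "al x = tilde p T #>\<^bsub>TG T\<^esub> y"
    unfolding module.rel_al_Phi by auto
  have "a01 module (al x) = \<one>\<^bsub>TG T\<^esub>" using module.a01_a12[of x] y(2) by simp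
  then have "y \<in> kerN p (TG T) (Tt T)" using y by (simp add: a01_module kerN_def)
  then show "rel_al p T x y" unfolding rel_al_iff using y by simp
next
  assume r: "rel_al p T x y"
  show "rel_al p (Phi p module) x y"
    unfolding module.rel_al_Phi using rel_al_closed[OF r] rel_al_al[OF r] by simp
qed

text \<open>The two triples may differ as records, since \<open>Tt\<close> and \<open>Tal\<close>
  are compared only where they matter. The identity preserves subgroup and relation in both
  directions; its restriction makes it extensional.\<close>

lemma triso_module: "triso p (Phi p module) T (restrict (\<lambda>x. x) (carrier (TG T)))"
proof -
  let ?g = "restrict (\<lambda>x. x) (carrier (TG T))"
  have gp: "gpres ?g (TG T) (Tgr T) (TG T) (Tgr T)"
    unfolding gpres_iff using gradedD(3)[OF graded] by (auto intro!: homI)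
  have res: "?g x = x" if "x \<in> carrier (TG T)" for x using that by simp
  have rel: "rel_al p T (?g x) (?g y)" if "rel_al p T x y" for x y
    using that rel_al_closed[OF that] by simp
  have "?g \<in> thoms p (Phi p module) T"
    unfolding thoms_iff[OF module.pretriple_Phi pretriple_axioms] Phi_simps module_simps tilde_module
      rel_al_module
    using gp rel W_closed by (auto simp: kt0_module)
  moreover have "?g \<in> thoms p T (Phi p module)"
    unfolding thoms_iff[OF pretriple_axioms module.pretriple_Phi] Phi_simps module_simps tilde_module
      rel_al_module
    using gp rel W_closed by (auto simp: kt0_module)
  ultimately show ?thesis unfolding triso_def by (intro conjI bexI[of _ ?g]) simp_all
qed

end

text \<open>Equivalence is expressed as a functor that is fully faithful and essentially surjective;
  on morphisms it is the projection \<open>fst\<close>, so compatibility with composition is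
  componentwise.\<close>

theorem theorem8p1:
  fixes p :: nat
  assumes "Factorial_Ring.prime p"
  shows
    "(\<forall>M :: ('a, 'b, 'c) kmod. kexact0 p M \<longrightarrow> valid_triple p (Phi p M)) \<and>
     (\<forall>(M :: ('a, 'b, 'c) kmod) (L :: ('d, 'e, 'f) kmod). kexact0 p M \<and> kexact0 p L \<longrightarrow>
        bij_betw fst (khoms M L) (thoms p (Phi p M) (Phi p L))) \<and>
     (\<forall>T :: 'a ktriple. valid_triple p T \<longrightarrow>
        (\<exists>M :: ('a, 'a set, 'a) kmod. kexact0 p M \<and> (\<exists>g. triso p (Phi p M) T g))) \<and>
     (\<forall>(M :: ('a, 'b, 'c) kmod) (L :: ('d, 'e, 'f) kmod) f0 f1 f2.
        kexact0 p M \<and> kexact0 p L \<and> (f0, f1, f2) \<in> khoms M L \<longrightarrow>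
        ((inj_on f0 (carrier (KG0 M)) \<and> inj_on f1 (carrier (KG1 M)) \<and> inj_on f2 (carrier (KG2 M)))
           \<longleftrightarrow> (inj_on f0 (carrier (KG0 M)) \<and>
                {x\<in>carrier (KG0 M). f0 x \<in> tilde p (Phi p L)} = tilde p (Phi p M))) \<and>
        ((f0 ` carrier (KG0 M) = carrier (KG0 L) \<and> f1 ` carrier (KG1 M) = carrier (KG1 L) \<and>
          f2 ` carrier (KG2 M) = carrier (KG2 L))
           \<longleftrightarrow> (f0 ` carrier (KG0 M) = carrier (KG0 L) \<and> f0 ` tilde p (Phi p M) = tilde p (Phi p L))))"
proof (intro conjI allI impI, goal_cases)
  case (1 M)
  then show ?case by (intro exact_kmod.valid_triple_Phi exact_kmod.intro)
next
  case (2 M L)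
  then show ?case by (intro khoms_bij_thoms exact_kmod.intro) auto
next
  case (3 T)
  then interpret exact_triple p T by unfold_locales
  show ?case using module.kexact0 triso_module by blast
next
  case (4 M L f0 f1 f2)
  then show ?case by (intro khoms_inj_iff exact_kmod.intro) auto
next
  case (5 M L f0 f1 f2)
  then show ?case by (intro khoms_surj_iff exact_kmod.intro) auto
qed

end
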